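(* Let $\nu$ be a positive finite Borel measure on $(0,1)$ such that $1\in\operatorname{supp}\nu$ and $$\int_{(0,1)}\frac{\mathrm d\nu(r)}{|r^2-a^2|}=\infty\quad\text{for every } a\in[0,1).$$ Let $\mu$ be the measure on $\mathbb D$ given by $\mathrm d\mu(r\zeta)=\mathrm dm(\zeta)\,\mathrm d\nu(r)$, $r\in(0,1)$, $\zeta\in\mathbb T$, let $\chi(z)=z$ for $z\in\mathbb D$, let $\overline{P^2(\mathbb D,\mu)}$ be the closed linear span of $\{\overline{\chi}^{\,n}: n\ge0\}$ in $L^2(\mathbb D,\mu)$, and let $\mathcal H=L^2(\mathbb D,\mu)\ominus\overline{P^2(\mathbb D,\mu)}$. Let $T$ be the operator of multiplication by $\chi$ acting on $\mathcal H$. Then $\varphi(T)\mathcal H$ is dense in $\mathcal H$ for every $\varphi\in H^\infty$ such that $\varphi\not\equiv0$.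
   Context: $\mathbb D$ is the open unit disc, $\mathbb T$ the unit circle, $m$ the normalized Lebesgue measure on $\mathbb T$, and $H^\infty$ the algebra of bounded analytic functions in $\mathbb D$. The support $\operatorname{supp}\nu$ is the closed support in $\mathbb R$, so $1\in\operatorname{supp}\nu$ means $\nu((1-\varepsilon,1))>0$ for all $\varepsilon>0$. The subspace $\mathcal H$ is invariant under multiplication by $\chi$ on $L^2(\mathbb D,\mu)$, so $T$ is well defined. For $\varphi\in H^\infty$, $\varphi(T)$ is given by the $H^\infty$-functional calculus; here it is the restriction to $\mathcal H$ of the operator of multiplication by $\varphi$ on $L^2(\mathbb D,\mu)$. *)

theory Defs
  imports "HOL-Probability.Probability" "HOL-Complex_Analysis.Complex_Analysis"
begin

section \<open>Measures\<close>

definition closed_support :: "'a::topological_space measure \<Rightarrow> 'a set" where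
  "closed_support \<nu> = {x. \<forall>U. open U \<longrightarrow> x \<in> U \<longrightarrow> emeasure \<nu> (U \<inter> space \<nu>) > 0}"

definition circle_measure :: "complex measure" where
  "circle_measure =
     distr (uniform_measure lborel {0..<2 * pi}) (restrict_space borel (sphere 0 1)) cis"

text \<open>The measure \<open>d\<mu>(r\<zeta>) = dm(\<zeta>) d\<nu>(r)\<close>, whose underlying space is the open unit disc.\<close>

definition polar_measure :: "real measure \<Rightarrow> complex measure" where
  "polar_measure \<nu> =
     distr (\<nu> \<Otimes>\<^sub>M circle_measure) (restrict_space borel (ball 0 1)) (\<lambda>(r, \<zeta>). of_real r * \<zeta>)"


section \<open>The space \<open>L\<^sup>2\<close>\<close>

text \<open>
  Elements of \<open>L\<^sup>2\<close> are represented by functions rather than by classes of functions equal almost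
  everywhere; \<open>L2_norm\<close> is thus a seminorm that identifies precisely such functions. The sets
  \<open>L2_closure M A\<close>, \<open>L2_orth M A\<close> and \<open>Hinf_range M T \<phi> H\<close> below contain all representatives of
  their elements.
\<close>

definition L2 :: "'a measure \<Rightarrow> ('a \<Rightarrow> complex) set" where
  "L2 M = {f. f \<in> borel_measurable M \<and> integrable M (\<lambda>z. (cmod (f z))\<^sup>2)}"

definition L2_norm :: "'a measure \<Rightarrow> ('a \<Rightarrow> complex) \<Rightarrow> real" where
  "L2_norm M f = sqrt (\<integral>z. (cmod (f z))\<^sup>2 \<partial>M)"

definition L2_inner :: "'a measure \<Rightarrow> ('a \<Rightarrow> complex) \<Rightarrow> ('a \<Rightarrow> complex) \<Rightarrow> complex" where
  "L2_inner M f g = (\<integral>z. f z * cnj (g z) \<partial>M)"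

definition L2_tendsto ::
  "'a measure \<Rightarrow> ('i \<Rightarrow> 'a \<Rightarrow> complex) \<Rightarrow> ('a \<Rightarrow> complex) \<Rightarrow> 'i filter \<Rightarrow> bool" where
  "L2_tendsto M X g F \<longleftrightarrow>
     g \<in> L2 M \<and> (\<forall>\<^sub>F i in F. X i \<in> L2 M) \<and> ((\<lambda>i. L2_norm M (\<lambda>z. X i z - g z)) \<longlongrightarrow> 0) F"

text \<open>Closure, span and orthogonal complement are meant for \<open>A \<subseteq> L2 M\<close>.\<close>

definition L2_closure :: "'a measure \<Rightarrow> ('a \<Rightarrow> complex) set \<Rightarrow> ('a \<Rightarrow> complex) set" where
  "L2_closure M A = {f \<in> L2 M. \<forall>\<epsilon>>0. \<exists>g\<in>A. L2_norm M (\<lambda>z. f z - g z) < \<epsilon>}"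

definition lin_span :: "('a \<Rightarrow> complex) set \<Rightarrow> ('a \<Rightarrow> complex) set" where
  "lin_span A = {\<lambda>z. \<Sum>g\<in>G. c g * g z | G c. finite G \<and> G \<subseteq> A}"

definition L2_orth :: "'a measure \<Rightarrow> ('a \<Rightarrow> complex) set \<Rightarrow> ('a \<Rightarrow> complex) set" where
  "L2_orth M A = {f \<in> L2 M. \<forall>g\<in>A. L2_inner M f g = 0}"

definition L2_dense_in :: "'a measure \<Rightarrow> ('a \<Rightarrow> complex) set \<Rightarrow> ('a \<Rightarrow> complex) set \<Rightarrow> bool" where
  "L2_dense_in M A H \<longleftrightarrow> A \<subseteq> H \<and> H \<subseteq> L2_closure M A"


section \<open>The spaces and operators on the disc\<close>

definition conj_P2 :: "complex measure \<Rightarrow> (complex \<Rightarrow> complex) set" where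
  "conj_P2 \<mu> = L2_closure \<mu> (lin_span (range (\<lambda>n z. cnj z ^ n)))"

definition mult_op :: "('a \<Rightarrow> complex) \<Rightarrow> ('a \<Rightarrow> complex) \<Rightarrow> 'a \<Rightarrow> complex" where
  "mult_op \<phi> f = (\<lambda>z. \<phi> z * f z)"

definition Hinf :: "(complex \<Rightarrow> complex) set" where
  "Hinf = {\<phi>. \<phi> holomorphic_on ball 0 1 \<and> bounded (\<phi> ` ball 0 1)}"

definition taylor_coeff :: "(complex \<Rightarrow> complex) \<Rightarrow> nat \<Rightarrow> complex" where
  "taylor_coeff \<phi> n = (deriv ^^ n) \<phi> 0 / fact n"

text \<open>
  The Sz.-Nagy--Foias calculus: \<open>\<phi>(T) f = lim\<^bsub>r\<rightarrow>1-\<^esub> \<phi>(r T) f\<close>, where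
  \<open>\<phi>(r T) = \<Sum>\<^sub>n a\<^sub>n r\<^sup>n T\<^sup>n\<close> with \<open>a\<^sub>n\<close> the Taylor coefficients of \<open>\<phi>\<close>; here \<open>S r\<close> is \<open>\<phi>(r T) f\<close>.
  As elements of \<open>L\<^sup>2\<close> are represented by functions, the calculus is a relation between \<open>f\<close> and
  the representatives \<open>g\<close> of \<open>\<phi>(T) f\<close>. For multiplication by \<open>z\<close> it yields multiplication
  by \<open>\<phi>\<close>, see \<open>Hinf_calculus_mult_op\<close> below.
\<close>

definition Hinf_calculus ::
  "'a measure \<Rightarrow> (('a \<Rightarrow> complex) \<Rightarrow> ('a \<Rightarrow> complex)) \<Rightarrow> (complex \<Rightarrow> complex) \<Rightarrow>
     ('a \<Rightarrow> complex) \<Rightarrow> ('a \<Rightarrow> complex) \<Rightarrow> bool" where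
  "Hinf_calculus M T \<phi> f g \<longleftrightarrow>
     (\<exists>S :: real \<Rightarrow> 'a \<Rightarrow> complex.
        (\<forall>r\<in>{0<..<1}. L2_tendsto M
           (\<lambda>N z. \<Sum>n<N. taylor_coeff \<phi> n * of_real r ^ n * (T ^^ n) f z) (S r) sequentially) \<and>
        L2_tendsto M S g (at_left 1))"

definition Hinf_range ::
  "'a measure \<Rightarrow> (('a \<Rightarrow> complex) \<Rightarrow> ('a \<Rightarrow> complex)) \<Rightarrow> (complex \<Rightarrow> complex) \<Rightarrow>
     ('a \<Rightarrow> complex) set \<Rightarrow> ('a \<Rightarrow> complex) set" where
  "Hinf_range M T \<phi> H = {g. \<exists>f\<in>H. Hinf_calculus M T \<phi> f g}"


section \<open>Consistency of the definitions\<close>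

lemma cis_measurable_circle [measurable]:
  "cis \<in> measurable (uniform_measure lborel {0..<2 * pi}) (restrict_space borel (sphere 0 1))"
proof -
  have "cis \<in> borel_measurable borel"
    by (intro borel_measurable_continuous_onI continuous_intros)
  then show ?thesis
    by (intro measurable_restrict_space2) auto
qed

lemma prob_space_circle_measure: "prob_space circle_measure"
  unfolding circle_measure_def
  by (intro prob_space.prob_space_distr prob_space_uniform_measure cis_measurable_circle) auto

lemma sets_polar_measure [measurable_cong]:
  "sets (polar_measure \<nu>) = sets (restrict_space borel (ball 0 1))"
  by (simp add: polar_measure_def)

lemma polar_map_measurable:
  fixes \<nu> :: "real measure"
  assumes "sets \<nu> = sets (restrict_space borel {0<..<1})"
  shows "(\<lambda>(r, \<zeta>). of_real r * \<zeta>) \<in>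
           measurable (\<nu> \<Otimes>\<^sub>M circle_measure) (restrict_space borel (ball 0 1 :: complex set))"
proof (rule measurable_restrict_space2)
  have sp: "space \<nu> = {0<..<1}"
    using sets_eq_imp_space_eq[OF assms] by (simp add: space_restrict_space)
  show "(\<lambda>(r, \<zeta>). of_real r * \<zeta>) \<in> space (\<nu> \<Otimes>\<^sub>M circle_measure) \<rightarrow> (ball 0 1 :: complex set)"
    by (auto simp: space_pair_measure sp circle_measure_def space_restrict_space norm_mult)
  have [measurable]: "(\<lambda>x. x) \<in> borel_measurable \<nu>"
    unfolding measurable_cong_sets[OF assms refl] by (rule measurable_restrict_space1) simp
  have [measurable]: "(\<lambda>x. x) \<in> borel_measurable circle_measure"
    unfolding circle_measure_def measurable_distr_eq1 by (rule measurable_restrict_space1) simp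
  have "(\<lambda>p. of_real (fst p) * snd p :: complex) \<in> borel_measurable (\<nu> \<Otimes>\<^sub>M circle_measure)"
    by measurable
  then show "(\<lambda>(r, \<zeta>). of_real r * \<zeta>) \<in> borel_measurable (\<nu> \<Otimes>\<^sub>M circle_measure)"
    by (simp add: case_prod_beta)
qed

lemma nn_integral_polar_measure:
  fixes \<nu> :: "real measure" and h :: "complex \<Rightarrow> ennreal"
  assumes "sets \<nu> = sets (restrict_space borel {0<..<1})"
    and h: "h \<in> borel_measurable (restrict_space borel (ball 0 1))"
  shows "(\<integral>\<^sup>+z. h z \<partial>polar_measure \<nu>) = (\<integral>\<^sup>+r. (\<integral>\<^sup>+\<zeta>. h (of_real r * \<zeta>) \<partial>circle_measure) \<partial>\<nu>)"
proof -
  interpret prob_space circle_measure by (rule prob_space_circle_measure)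
  note m = polar_map_measurable[OF assms(1)]
  have "(\<integral>\<^sup>+z. h z \<partial>polar_measure \<nu>) =
      (\<integral>\<^sup>+p. h (case p of (r, \<zeta>) \<Rightarrow> of_real r * \<zeta>) \<partial>(\<nu> \<Otimes>\<^sub>M circle_measure))"
    unfolding polar_measure_def by (rule nn_integral_distr[OF m]) (use h in simp)
  also have "\<dots> = (\<integral>\<^sup>+r. (\<integral>\<^sup>+\<zeta>. h (of_real r * \<zeta>) \<partial>circle_measure) \<partial>\<nu>)"
    by (subst nn_integral_fst[symmetric]) (use measurable_compose[OF m h] in \<open>simp_all add: case_prod_beta\<close>)
  finally show ?thesis .
qed

lemma L2_diff:
  assumes "f \<in> L2 M" "g \<in> L2 M"
  shows "(\<lambda>z. f z - g z) \<in> L2 M"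
proof -
  have [measurable]: "f \<in> borel_measurable M" "g \<in> borel_measurable M"
    using assms by (auto simp: L2_def)
  have "integrable M (\<lambda>z. 2 * (cmod (f z))\<^sup>2 + 2 * (cmod (g z))\<^sup>2)"
    using assms by (auto simp: L2_def)
  moreover have "(cmod (f z - g z))\<^sup>2 \<le> 2 * (cmod (f z))\<^sup>2 + 2 * (cmod (g z))\<^sup>2" for z
  proof -
    have "(cmod (f z - g z))\<^sup>2 \<le> (cmod (f z) + cmod (g z))\<^sup>2"
      by (intro power_mono norm_triangle_ineq4) auto
    also have "\<dots> \<le> 2 * (cmod (f z))\<^sup>2 + 2 * (cmod (g z))\<^sup>2"
      using sum_squares_bound[of "cmod (f z)" "cmod (g z)"] by (simp add: power2_sum)
    finally show ?thesis .
  qed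
  ultimately have "integrable M (\<lambda>z. (cmod (f z - g z))\<^sup>2)"
    by (elim Bochner_Integration.integrable_bound) auto
  then show ?thesis
    by (simp add: L2_def)
qed

lemma L2_tendsto_unique:
  assumes X: "L2_tendsto M X f F" and Y: "L2_tendsto M X g F" and "F \<noteq> bot"
  shows "AE z in M. f z = g z"
proof -
  have L: "f \<in> L2 M" "g \<in> L2 M"
    using X Y by (auto simp: L2_tendsto_def)
  define n where "n h = (\<integral>z. (cmod (h z))\<^sup>2 \<partial>M)" for h
  have n: "n h = (L2_norm M h)\<^sup>2" for h
    by (simp add: n_def L2_norm_def)
  have "\<forall>\<^sub>F i in F. X i \<in> L2 M"
    using X by (auto simp: L2_tendsto_def)
  then have "\<forall>\<^sub>F i in F. n (\<lambda>z. f z - g z) \<le> 2 * n (\<lambda>z. X i z - f z) + 2 * n (\<lambda>z. X i z - g z)"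
  proof eventually_elim
    case (elim i)
    have i: "integrable M (\<lambda>z. (cmod (X i z - f z))\<^sup>2)" "integrable M (\<lambda>z. (cmod (X i z - g z))\<^sup>2)"
        "integrable M (\<lambda>z. (cmod (f z - g z))\<^sup>2)"
      using L2_diff[OF elim L(1)] L2_diff[OF elim L(2)] L2_diff[OF L] by (auto simp: L2_def)
    have b: "(cmod (f z - g z))\<^sup>2 \<le> 2 * (cmod (X i z - f z))\<^sup>2 + 2 * (cmod (X i z - g z))\<^sup>2" for z
    proof -
      have "cmod (f z - g z) \<le> cmod (X i z - f z) + cmod (X i z - g z)"
        using norm_triangle_ineq4[of "X i z - g z" "X i z - f z"] by simp
      then have "(cmod (f z - g z))\<^sup>2 \<le> (cmod (X i z - f z) + cmod (X i z - g z))\<^sup>2"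
        by (intro power_mono) auto
      also have "\<dots> \<le> 2 * (cmod (X i z - f z))\<^sup>2 + 2 * (cmod (X i z - g z))\<^sup>2"
        using sum_squares_bound[of "cmod (X i z - f z)" "cmod (X i z - g z)"]
        by (simp add: power2_sum)
      finally show ?thesis .
    qed
    have "n (\<lambda>z. f z - g z) \<le> (\<integral>z. 2 * (cmod (X i z - f z))\<^sup>2 + 2 * (cmod (X i z - g z))\<^sup>2 \<partial>M)"
      unfolding n_def by (intro integral_mono i b) (use i in auto)
    also have "\<dots> = 2 * n (\<lambda>z. X i z - f z) + 2 * n (\<lambda>z. X i z - g z)"
      using i by (simp add: n_def)
    finally show ?case .
  qed
  moreover have "((\<lambda>i. 2 * n (\<lambda>z. X i z - f z) + 2 * n (\<lambda>z. X i z - g z)) \<longlongrightarrow> 2 * 0\<^sup>2 + 2 * 0\<^sup>2) F"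
    unfolding n by (intro tendsto_intros) (use X Y in \<open>auto simp: L2_tendsto_def\<close>)
  ultimately have "n (\<lambda>z. f z - g z) \<le> 0"
    using tendsto_lowerbound[OF _ _ \<open>F \<noteq> bot\<close>] by fastforce
  moreover have "n (\<lambda>z. f z - g z) \<ge> 0"
    by (simp add: n_def)
  ultimately have "(\<integral>z. (cmod (f z - g z))\<^sup>2 \<partial>M) = 0"
    unfolding n_def by linarith
  moreover have "integrable M (\<lambda>z. (cmod (f z - g z))\<^sup>2)"
    using L2_diff[OF L] by (auto simp: L2_def)
  ultimately show ?thesis
    by (subst (asm) integral_nonneg_eq_0_iff_AE) auto
qed

lemma L2_norm_cong_AE:
  assumes "f \<in> L2 M" "g \<in> L2 M" "AE z in M. f z = g z"
  shows "L2_norm M f = L2_norm M g"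
proof -
  have [measurable]: "f \<in> borel_measurable M" "g \<in> borel_measurable M"
    using assms by (auto simp: L2_def)
  show ?thesis
    unfolding L2_norm_def using assms(3)
    by (intro arg_cong[of _ _ sqrt] integral_cong_AE) auto
qed

lemma L2_tendsto_cong_AE:
  assumes X: "L2_tendsto M X f F" and "g \<in> L2 M" "AE z in M. f z = g z"
    and Y: "\<forall>\<^sub>F i in F. Y i \<in> L2 M \<and> (AE z in M. X i z = Y i z)"
  shows "L2_tendsto M Y g F"
proof -
  have f: "f \<in> L2 M" and "\<forall>\<^sub>F i in F. X i \<in> L2 M"
    and lim: "((\<lambda>i. L2_norm M (\<lambda>z. X i z - f z)) \<longlongrightarrow> 0) F"
    using X by (auto simp: L2_tendsto_def)
  from this(2) Y have "\<forall>\<^sub>F i in F. L2_norm M (\<lambda>z. X i z - f z) = L2_norm M (\<lambda>z. Y i z - g z)"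
  proof eventually_elim
    case (elim i)
    then have "AE z in M. X i z = Y i z"
      by auto
    then have "AE z in M. X i z - f z = Y i z - g z"
      using assms(3) by eventually_elim auto
    then show ?case
      using elim f assms(2) by (intro L2_norm_cong_AE L2_diff) auto
  qed
  then have "((\<lambda>i. L2_norm M (\<lambda>z. Y i z - g z)) \<longlongrightarrow> 0) F"
    using lim by (rule Lim_transform_eventually[rotated])
  moreover have "\<forall>\<^sub>F i in F. Y i \<in> L2 M"
    using Y by eventually_elim auto
  ultimately show ?thesis
    using assms(2) by (auto simp: L2_tendsto_def)
qed

lemma L2_mult_bounded:
  assumes f: "f \<in> L2 M" and h: "h \<in> borel_measurable M" and B: "\<And>z. z \<in> space M \<Longrightarrow> cmod (h z) \<le> B"
  shows "(\<lambda>z. h z * f z) \<in> L2 M"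
proof -
  have [measurable]: "f \<in> borel_measurable M"
    using f by (auto simp: L2_def)
  have "integrable M (\<lambda>z. B\<^sup>2 * (cmod (f z))\<^sup>2)"
    using f by (auto simp: L2_def)
  then have "integrable M (\<lambda>z. (cmod (h z * f z))\<^sup>2)"
    by (rule Bochner_Integration.integrable_bound)
      (use h B in \<open>auto simp: norm_mult power_mult_distrib intro!: AE_I2 mult_right_mono power_mono\<close>)
  then show ?thesis
    using h by (auto simp: L2_def)
qed

lemma L2_tendsto_mult_sequentially:
  fixes h :: "nat \<Rightarrow> 'a \<Rightarrow> complex"
  assumes f: "f \<in> L2 M" and h: "\<And>n. h n \<in> borel_measurable M" and h0: "h0 \<in> borel_measurable M"
    and B: "\<And>n z. z \<in> space M \<Longrightarrow> cmod (h n z) \<le> B"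
    and B0: "\<And>z. z \<in> space M \<Longrightarrow> cmod (h0 z) \<le> B"
    and lim: "\<And>z. z \<in> space M \<Longrightarrow> (\<lambda>n. h n z) \<longlonglongrightarrow> h0 z"
  shows "L2_tendsto M (\<lambda>n z. h n z * f z) (\<lambda>z. h0 z * f z) sequentially"
proof -
  note [measurable] = h h0
  have [measurable]: "f \<in> borel_measurable M"
    using f by (auto simp: L2_def)
  have "(\<lambda>n. \<integral>z. (cmod (h n z * f z - h0 z * f z))\<^sup>2 \<partial>M) \<longlonglongrightarrow> (\<integral>z. 0 \<partial>M)"
  proof (rule integral_dominated_convergence)
    show "integrable M (\<lambda>z. (2 * B)\<^sup>2 * (cmod (f z))\<^sup>2)"
      using f by (auto simp: L2_def)
    show "AE z in M. (\<lambda>n. (cmod (h n z * f z - h0 z * f z))\<^sup>2) \<longlonglongrightarrow> 0"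
    proof (rule AE_I2)
      fix z assume "z \<in> space M"
      then have "(\<lambda>n. (cmod (h n z * f z - h0 z * f z))\<^sup>2) \<longlonglongrightarrow> (cmod (h0 z * f z - h0 z * f z))\<^sup>2"
        by (intro tendsto_intros lim)
      then show "(\<lambda>n. (cmod (h n z * f z - h0 z * f z))\<^sup>2) \<longlonglongrightarrow> 0"
        by simp
    qed
    show "AE z in M. norm ((cmod (h n z * f z - h0 z * f z))\<^sup>2) \<le> (2 * B)\<^sup>2 * (cmod (f z))\<^sup>2" for n
    proof (rule AE_I2)
      fix z assume z: "z \<in> space M"
      have "cmod (h n z - h0 z) \<le> 2 * B"
        using norm_triangle_ineq4[of "h n z" "h0 z"] B[OF z, of n] B0[OF z] by linarith
      then have "(cmod (h n z - h0 z))\<^sup>2 * (cmod (f z))\<^sup>2 \<le> (2 * B)\<^sup>2 * (cmod (f z))\<^sup>2"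
        by (intro mult_right_mono power_mono) auto
      then show "norm ((cmod (h n z * f z - h0 z * f z))\<^sup>2) \<le> (2 * B)\<^sup>2 * (cmod (f z))\<^sup>2"
        by (simp add: norm_mult power_mult_distrib flip: left_diff_distrib)
    qed
  qed auto
  then have "(\<lambda>n. sqrt (\<integral>z. (cmod (h n z * f z - h0 z * f z))\<^sup>2 \<partial>M)) \<longlonglongrightarrow> sqrt 0"
    by (intro tendsto_real_sqrt) simp
  then show ?thesis
    using L2_mult_bounded[OF f h B] L2_mult_bounded[OF f h0 B0]
    by (simp add: L2_tendsto_def L2_norm_def)
qed

lemma mult_op_funpow: "(mult_op (\<lambda>z. z) ^^ n) f = (\<lambda>z. z ^ n * f z)"
  by (induction n) (auto simp: mult_op_def mult_ac)

lemma Hinf_mult_L2: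
  assumes M: "sets M = sets (restrict_space borel (ball 0 1))" and \<phi>: "\<phi> \<in> Hinf" and f: "f \<in> L2 M"
  shows "mult_op \<phi> f \<in> L2 M"
    and "\<And>r. r \<in> {0<..<1} \<Longrightarrow> L2_tendsto M
           (\<lambda>N z. \<Sum>n<N. taylor_coeff \<phi> n * of_real r ^ n * (mult_op (\<lambda>z. z) ^^ n) f z)
           (mult_op (\<lambda>z. \<phi> (of_real r * z)) f) sequentially"
    and "L2_tendsto M (\<lambda>r. mult_op (\<lambda>z. \<phi> (of_real r * z)) f) (mult_op \<phi> f) (at_left 1)"
proof -
  have sp: "space M = ball 0 1"
    using sets_eq_imp_space_eq[OF M] by (simp add: space_restrict_space)
  have hol: "\<phi> holomorphic_on ball 0 1" and "bounded (\<phi> ` ball 0 1)"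
    using \<phi> by (auto simp: Hinf_def)
  then obtain B where B: "\<And>z. z \<in> ball 0 1 \<Longrightarrow> cmod (\<phi> z) \<le> B"
    unfolding bounded_iff by blast
  have cont: "h \<in> borel_measurable M" if "continuous_on (ball 0 1) h" for h :: "complex \<Rightarrow> complex"
    using borel_measurable_continuous_on_restrict[OF that]
    by (simp add: measurable_cong_sets[OF M refl])
  have m: "\<phi> \<in> borel_measurable M"
    by (intro cont holomorphic_on_imp_continuous_on hol)
  have rb: "of_real r * z \<in> ball 0 1" if "r \<in> {0<..<1}" "z \<in> ball 0 1" for r :: real and z :: complex
  proof -
    have "r * cmod z < 1 * 1"
      using that by (intro mult_strict_mono) auto
    then show ?thesis
      using that by (simp add: norm_mult)
  qed
  have mr: "(\<lambda>z. \<phi> (of_real r * z)) \<in> borel_measurable M" if "r \<in> {0<..<1}" for r :: real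
    by (intro cont continuous_on_compose2[OF holomorphic_on_imp_continuous_on[OF hol]]
        continuous_intros) (use rb[OF that] in auto)
  show "mult_op \<phi> f \<in> L2 M"
    unfolding mult_op_def using B by (intro L2_mult_bounded[OF f m]) (auto simp: sp)
  have ser: "(\<lambda>n. taylor_coeff \<phi> n * w ^ n) sums \<phi> w" if "w \<in> ball 0 1" for w
    using holomorphic_power_series[OF hol that] by (simp add: taylor_coeff_def)
  show "L2_tendsto M
           (\<lambda>N z. \<Sum>n<N. taylor_coeff \<phi> n * of_real r ^ n * (mult_op (\<lambda>z. z) ^^ n) f z)
           (mult_op (\<lambda>z. \<phi> (of_real r * z)) f) sequentially" if r: "r \<in> {0<..<1}" for r
  proof -
    define c where "c n = cmod (taylor_coeff \<phi> n) * r ^ n" for n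
    define s where "s = (1 + r) / 2"
    have "summable (\<lambda>n. taylor_coeff \<phi> n * of_real s ^ n)"
    proof (rule sums_summable[OF ser])
      have "cmod (of_real s) < 1"
        using r by (simp add: s_def del: of_real_divide of_real_add)
      then show "of_real s \<in> ball (0::complex) 1"
        by simp
    qed
    then have "summable (\<lambda>n. cmod (taylor_coeff \<phi> n * of_real r ^ n))"
      by (rule powser_insidea) (use r in \<open>simp add: s_def del: of_real_divide of_real_add\<close>)
    then have c: "summable c"
      using r unfolding c_def by (simp add: norm_mult norm_power)
    have c0: "c n \<ge> 0" for n
      using r by (simp add: c_def)
    have "L2_tendsto M (\<lambda>N z. (\<Sum>n<N. taylor_coeff \<phi> n * (of_real r * z) ^ n) * f z)
        (\<lambda>z. \<phi> (of_real r * z) * f z) sequentially"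
    proof (rule L2_tendsto_mult_sequentially[OF f, where B = "max B (suminf c)"])
      show "(\<lambda>z. \<Sum>n<N. taylor_coeff \<phi> n * (of_real r * z) ^ n) \<in> borel_measurable M" for N
        by (intro cont continuous_intros)
      show "(\<lambda>z. \<phi> (of_real r * z)) \<in> borel_measurable M"
        by (rule mr[OF r])
      show "cmod (\<phi> (of_real r * z)) \<le> max B (suminf c)" if "z \<in> space M" for z
        using B[OF rb[OF r]] that by (auto simp: sp le_max_iff_disj)
      show "(\<lambda>N. \<Sum>n<N. taylor_coeff \<phi> n * (of_real r * z) ^ n) \<longlonglongrightarrow> \<phi> (of_real r * z)"
        if "z \<in> space M" for z
        using ser[OF rb[OF r]] that by (auto simp: sp sums_def)
      show "cmod (\<Sum>n<N. taylor_coeff \<phi> n * (of_real r * z) ^ n) \<le> max B (suminf c)"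
        if z: "z \<in> space M" for N z
      proof -
        have "cmod (\<Sum>n<N. taylor_coeff \<phi> n * (of_real r * z) ^ n) \<le> (\<Sum>n<N. c n)"
        proof (rule sum_norm_le)
          fix n
          have "cmod (of_real r * z) ^ n \<le> r ^ n"
            using r z by (intro power_mono) (auto simp: sp norm_mult mult_left_le)
          then show "cmod (taylor_coeff \<phi> n * (of_real r * z) ^ n) \<le> c n"
            by (auto simp: c_def norm_mult[of "taylor_coeff \<phi> n"] norm_power intro!: mult_left_mono)
        qed
        also have "\<dots> \<le> suminf c"
          using c c0 by (intro sum_le_suminf) auto
        finally show ?thesis by simp
      qed
    qed
    then show ?thesis
      by (simp add: mult_op_funpow mult_op_def sum_distrib_right power_mult_distrib mult.assoc)
  qed
  have "(\<lambda>r. mult_op (\<lambda>z. \<phi> (of_real r * z)) f) r \<in> L2 M" if "r \<in> {0<..<1}" for r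
    unfolding mult_op_def using B[OF rb[OF that]]
    by (intro L2_mult_bounded[OF f mr[OF that]]) (auto simp: sp)
  moreover have ev: "\<forall>\<^sub>F r in at_left (1::real). r \<in> {0<..<1}"
    using eventually_at_left_real[of 0 1] by simp
  ultimately have "\<forall>\<^sub>F r in at_left 1. mult_op (\<lambda>z. \<phi> (of_real r * z)) f \<in> L2 M"
    by (auto elim: eventually_mono)
  moreover have "((\<lambda>r. L2_norm M (\<lambda>z. mult_op (\<lambda>z. \<phi> (of_real r * z)) f z - mult_op \<phi> f z)) \<longlongrightarrow> 0) (at_left 1)"
  proof (rule tendsto_at_left_sequentially[of 0])
    fix R :: "nat \<Rightarrow> real"
    assume R: "\<And>n. R n < 1" "\<And>n. 0 < R n" "R \<longlonglongrightarrow> 1"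
    then have R': "R n \<in> {0<..<1}" for n by simp
    have "L2_tendsto M (\<lambda>n z. \<phi> (of_real (R n) * z) * f z) (\<lambda>z. \<phi> z * f z) sequentially"
    proof (rule L2_tendsto_mult_sequentially[OF f mr[OF R'] m, where B = B])
      fix z assume z: "z \<in> space M"
      show "cmod (\<phi> (of_real (R n) * z)) \<le> B" for n
        using z rb[OF R'] by (intro B) (simp add: sp)
      show "cmod (\<phi> z) \<le> B"
        using z by (intro B) (simp add: sp)
      have "isCont \<phi> z"
        using holomorphic_on_imp_continuous_on[OF hol] z
        by (simp add: sp continuous_on_eq_continuous_at)
      moreover have "(\<lambda>n. of_real (R n) * z) \<longlonglongrightarrow> of_real 1 * z"
        by (intro tendsto_intros R)
      ultimately show "(\<lambda>n. \<phi> (of_real (R n) * z)) \<longlonglongrightarrow> \<phi> z"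
        using isCont_tendsto_compose[of z \<phi>] by simp
    qed
    then show "(\<lambda>n. L2_norm M (\<lambda>z. mult_op (\<lambda>z. \<phi> (of_real (R n) * z)) f z - mult_op \<phi> f z)) \<longlonglongrightarrow> 0"
      by (simp add: L2_tendsto_def mult_op_def)
  qed simp
  ultimately show "L2_tendsto M (\<lambda>r. mult_op (\<lambda>z. \<phi> (of_real r * z)) f) (mult_op \<phi> f) (at_left 1)"
    using \<open>mult_op \<phi> f \<in> L2 M\<close> by (simp add: L2_tendsto_def)
qed

theorem Hinf_calculus_mult_op:
  assumes M: "sets M = sets (restrict_space borel (ball 0 1))" and \<phi>: "\<phi> \<in> Hinf" and f: "f \<in> L2 M"
  shows "Hinf_calculus M (mult_op (\<lambda>z. z)) \<phi> f g \<longleftrightarrow> g \<in> L2 M \<and> (AE z in M. g z = \<phi> z * f z)"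
proof
  note * = Hinf_mult_L2[OF M \<phi> f]
  assume "Hinf_calculus M (mult_op (\<lambda>z. z)) \<phi> f g"
  then obtain S where S: "\<And>r. r \<in> {0<..<1} \<Longrightarrow> L2_tendsto M
      (\<lambda>N z. \<Sum>n<N. taylor_coeff \<phi> n * of_real r ^ n * (mult_op (\<lambda>z. z) ^^ n) f z) (S r) sequentially"
    and g: "L2_tendsto M S g (at_left 1)"
    unfolding Hinf_calculus_def by blast
  have "\<forall>\<^sub>F r in at_left (1::real). r \<in> {0<..<1}"
    using eventually_at_left_real[of 0 1] by simp
  then have "\<forall>\<^sub>F r in at_left 1. mult_op (\<lambda>z. \<phi> (of_real r * z)) f \<in> L2 M \<and>
      (AE z in M. S r z = mult_op (\<lambda>z. \<phi> (of_real r * z)) f z)"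
  proof eventually_elim
    case (elim r)
    then show ?case
      using L2_tendsto_unique[OF S *(2), of r] *(2)[of r] by (auto simp: L2_tendsto_def)
  qed
  moreover have "g \<in> L2 M"
    using g by (auto simp: L2_tendsto_def)
  ultimately have "L2_tendsto M (\<lambda>r. mult_op (\<lambda>z. \<phi> (of_real r * z)) f) g (at_left 1)"
    using g by (intro L2_tendsto_cong_AE[OF g]) auto
  from L2_tendsto_unique[OF this *(3)] \<open>g \<in> L2 M\<close>
  show "g \<in> L2 M \<and> (AE z in M. g z = \<phi> z * f z)"
    by (simp add: mult_op_def trivial_limit_at_left_real)
next
  note * = Hinf_mult_L2[OF M \<phi> f]
  assume g: "g \<in> L2 M \<and> (AE z in M. g z = \<phi> z * f z)"
  have "L2_tendsto M (\<lambda>r. mult_op (\<lambda>z. \<phi> (of_real r * z)) f) g (at_left 1)"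
  proof (rule L2_tendsto_cong_AE[OF *(3)])
    show "AE z in M. mult_op \<phi> f z = g z"
      using g by (auto simp: mult_op_def elim: eventually_mono)
    show "\<forall>\<^sub>F r in at_left 1. mult_op (\<lambda>z. \<phi> (of_real r * z)) f \<in> L2 M \<and>
        (AE z in M. mult_op (\<lambda>z. \<phi> (of_real r * z)) f z = mult_op (\<lambda>z. \<phi> (of_real r * z)) f z)"
      using *(3) by (simp add: L2_tendsto_def)
  qed (use g in auto)
  then show "Hinf_calculus M (mult_op (\<lambda>z. z)) \<phi> f g"
    unfolding Hinf_calculus_def
    by (intro exI[of _ "\<lambda>r. mult_op (\<lambda>z. \<phi> (of_real r * z)) f"] conjI ballI *(2))
qed

end

theory Submission
  imports Defs
begin

text \<open>
  As \<open>H\<close> is a closed subspace containing \<open>\<phi>H\<close>, the projection theorem reduces the claim to showing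
  that every \<open>g \<in> H\<close> orthogonal to \<open>\<phi>H\<close> vanishes almost everywhere. For such \<open>g\<close> and every \<open>f \<in> H\<close> one has \<open>\<langle>cnj \<phi> g, f\<rangle> = cnj \<langle>\<phi> f, g\<rangle> = 0\<close>,
  so \<open>cnj \<phi> g\<close> lies in the double orthogonal complement of the conjugate polynomials, which is
  their closure. In other words \<open>F = \<phi> cnj g\<close> is an \<open>L\<^sup>2\<close>-limit of analytic polynomials.

  As \<open>1\<close> is in the support of \<open>\<nu>\<close>, the moments \<open>\<integral>r\<^sup>2\<^sup>n d\<nu>\<close>, which are the squared norms of the
  monomials, decay slower than every geometric sequence with ratio below \<open>1\<close>. Evaluation of
  polynomials at points of the disc is therefore bounded in the \<open>L\<^sup>2\<close>-norm, uniformly on smaller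
  discs, and \<open>F\<close> coincides almost everywhere with an analytic function
  (\<open>polynomial_limit_analytic\<close>).

  Hence \<open>cnj g\<close> is almost everywhere the meromorphic function \<open>F/\<phi>\<close>, and it is square integrable.
  If \<open>F/\<phi>\<close> had a pole at a point \<open>w\<close> of the disc, then \<open>1/\<bar>z - w\<bar>\<^sup>2\<close> would be integrable. Its mean
  over the circle of radius \<open>r\<close> is \<open>1/\<bar>r\<^sup>2 - \<bar>w\<bar>\<^sup>2\<bar>\<close> by the Poisson kernel, so the divergence
  hypothesis on \<open>\<nu>\<close> forbids this (\<open>square_integrable_quotient_analytic\<close>). Thus \<open>cnj g\<close> is almost
  everywhere an analytic function \<open>k\<close>.

  Finally \<open>g \<in> H\<close> says that \<open>k\<close> is orthogonal to all monomials. Since the measure is rotation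
  invariant, these inner products are the Taylor coefficients of \<open>k\<close> times the moments of \<open>\<nu>\<close>;
  so \<open>k = 0\<close>.
\<close>

section \<open>Geometry of square integrable functions\<close>

lemma L2_norm_nonneg [simp]: "L2_norm M f \<ge> 0"
  by (simp add: L2_norm_def)

lemma L2_norm_power2: "(L2_norm M f)\<^sup>2 = (\<integral>z. (cmod (f z))\<^sup>2 \<partial>M)"
  by (simp add: L2_norm_def)

lemma L2_norm_cnj: "L2_norm M (\<lambda>z. cnj (f z)) = L2_norm M f"
  by (simp add: L2_norm_def)

lemma L2_norm_minus_commute: "L2_norm M (\<lambda>z. f z - g z) = L2_norm M (\<lambda>z. g z - f z)"
  by (simp add: L2_norm_def norm_minus_commute)

lemma L2_cnj:
  assumes "f \<in> L2 M"
  shows "(\<lambda>z. cnj (f z)) \<in> L2 M"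
proof -
  have "cnj \<in> borel_measurable borel"
    by (intro borel_measurable_continuous_onI continuous_intros)
  then show ?thesis
    using assms measurable_compose[of f M borel cnj borel] by (simp add: L2_def)
qed

lemma L2_scale: "f \<in> L2 M \<Longrightarrow> (\<lambda>z. c * f z) \<in> L2 M"
  by (intro L2_mult_bounded[where B = "cmod c"]) auto

lemma L2_add:
  assumes "f \<in> L2 M" "g \<in> L2 M"
  shows "(\<lambda>z. f z + g z) \<in> L2 M"
  using L2_diff[OF assms(1) L2_scale[OF assms(2), of "-1"]] by simp

lemma L2_integrable_inner:
  assumes "f \<in> L2 M" "g \<in> L2 M"
  shows "integrable M (\<lambda>z. f z * cnj (g z))"
proof -
  have [measurable]: "f \<in> borel_measurable M" "(\<lambda>z. cnj (g z)) \<in> borel_measurable M"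
    using assms L2_cnj[OF assms(2)] by (auto simp: L2_def)
  have "integrable M (\<lambda>z. (cmod (f z))\<^sup>2 + (cmod (g z))\<^sup>2)"
    using assms by (auto simp: L2_def)
  moreover have "cmod (f z) * cmod (g z) \<le> (cmod (f z))\<^sup>2 + (cmod (g z))\<^sup>2" for z
    using sum_squares_bound[of "cmod (f z)" "cmod (g z)"] by (simp add: mult_ac)
      (smt (verit) mult_nonneg_nonneg norm_ge_zero)
  ultimately show ?thesis
    by (elim Bochner_Integration.integrable_bound) (auto simp: norm_mult)
qed

lemma L2_inner_commute: "L2_inner M g f = cnj (L2_inner M f g)"
  unfolding L2_inner_def by (simp add: mult.commute flip: Bochner_Integration.integral_cnj)

lemma L2_inner_self: "L2_inner M f f = of_real ((L2_norm M f)\<^sup>2)"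
proof -
  have "L2_inner M f f = (\<integral>z. complex_of_real ((cmod (f z))\<^sup>2) \<partial>M)"
    unfolding L2_inner_def by (simp only: complex_norm_square)
  then show ?thesis
    by (simp add: L2_norm_power2 del: of_real_power)
qed

lemma L2_inner_diff_left:
  assumes "f \<in> L2 M" "g \<in> L2 M" "h \<in> L2 M"
  shows "L2_inner M (\<lambda>z. f z - g z) h = L2_inner M f h - L2_inner M g h"
  using assms by (simp add: L2_inner_def left_diff_distrib L2_integrable_inner)

lemma L2_inner_scale_left: "L2_inner M (\<lambda>z. c * f z) h = c * L2_inner M f h"
  by (simp add: L2_inner_def mult.assoc)

text \<open>
  Cauchy--Schwarz, the triangle inequality, the parallelogram identity and the variational
  characterisation of the projection are all read off from this expansion, by choosing \<open>c\<close>.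
\<close>

lemma L2_norm_diff_scale:
  assumes f: "f \<in> L2 M" and g: "g \<in> L2 M"
  shows "(L2_norm M (\<lambda>z. f z - c * g z))\<^sup>2 =
     (L2_norm M f)\<^sup>2 - 2 * Re (cnj c * L2_inner M f g) + (cmod c)\<^sup>2 * (L2_norm M g)\<^sup>2"
proof -
  have j: "integrable M (\<lambda>z. Re (cnj c * (f z * cnj (g z))))"
    by (intro integrable_Re Bochner_Integration.integrable_mult_right) (rule L2_integrable_inner[OF f g])
  have i: "integrable M (\<lambda>z. (cmod (f z))\<^sup>2)" "integrable M (\<lambda>z. (cmod (g z))\<^sup>2)"
    using f g by (auto simp: L2_def)
  have pw: "(cmod (f z - c * g z))\<^sup>2 =
      (cmod (f z))\<^sup>2 - 2 * Re (cnj c * (f z * cnj (g z))) + (cmod c)\<^sup>2 * (cmod (g z))\<^sup>2" for z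
    unfolding cmod_power2 by (simp add: algebra_simps power2_eq_square)
  have "(\<integral>z. Re (cnj c * (f z * cnj (g z))) \<partial>M) = Re (cnj c * L2_inner M f g)"
    unfolding L2_inner_def by (subst integral_Re) (simp_all add: L2_integrable_inner f g)
  then show ?thesis
    unfolding L2_norm_power2 pw using i j by (simp del: times_complex.sel)
qed

lemma L2_Cauchy_Schwarz:
  assumes f: "f \<in> L2 M" and g: "g \<in> L2 M"
  shows "cmod (L2_inner M f g) \<le> L2_norm M f * L2_norm M g"
proof -
  let ?a = "L2_inner M f g"
  \<comment> \<open>The expansion of \<open>L2_norm_diff_scale\<close> with \<open>c = t \<langle>f, g\<rangle>\<close>, for all real \<open>t\<close>.\<close>
  have *: "2 * t * (cmod ?a)\<^sup>2 \<le> (L2_norm M f)\<^sup>2 + t\<^sup>2 * ((cmod ?a)\<^sup>2 * (L2_norm M g)\<^sup>2)" for t :: real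
  proof -
    have "cnj ?a * ?a = of_real ((cmod ?a)\<^sup>2)"
      by (metis complex_norm_square mult.commute)
    then have "0 \<le> (L2_norm M f)\<^sup>2 - 2 * (t * (cmod ?a)\<^sup>2) + (t * cmod ?a)\<^sup>2 * (L2_norm M g)\<^sup>2"
      using L2_norm_diff_scale[OF f g, of "of_real t * ?a"]
      by (simp add: norm_mult mult.assoc del: of_real_power)
        (metis (no_types, lifting) abs_norm_cancel power2_abs power_mult_distrib zero_le_power2)
    then show ?thesis
      by (simp add: power_mult_distrib algebra_simps)
  qed
  have "(cmod ?a)\<^sup>2 \<le> (L2_norm M f)\<^sup>2 * (L2_norm M g)\<^sup>2"
  proof (cases "cmod ?a = 0 \<or> L2_norm M g = 0")
    case True
    moreover have "cmod ?a = 0" if "L2_norm M g = 0"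
    proof (rule ccontr)
      assume "cmod ?a \<noteq> 0"
      then have "2 * (1 + (L2_norm M f)\<^sup>2) \<le> (L2_norm M f)\<^sup>2"
        using *[of "(1 + (L2_norm M f)\<^sup>2) / (cmod ?a)\<^sup>2"] that by simp
      then show False
        using zero_le_power2[of "L2_norm M f"] by (simp add: algebra_simps)
    qed
    ultimately show ?thesis by auto
  next
    case False
    define B where "B = (L2_norm M g)\<^sup>2"
    have B: "B > 0" using False by (simp add: B_def)
    have "(1 / B)\<^sup>2 * ((cmod ?a)\<^sup>2 * B) = (cmod ?a)\<^sup>2 / B"
      using B by (simp add: power2_eq_square)
    then have "(cmod ?a)\<^sup>2 / B \<le> (L2_norm M f)\<^sup>2"
      using *[of "1 / B"] by (simp add: B_def)
    then show ?thesis
      using B by (simp add: pos_divide_le_eq B_def)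
  qed
  then show ?thesis
    by (metis L2_norm_nonneg mult_nonneg_nonneg power2_le_imp_le power_mult_distrib)
qed

lemma L2_norm_triangle:
  assumes f: "f \<in> L2 M" and g: "g \<in> L2 M" and h: "h \<in> L2 M"
  shows "L2_norm M (\<lambda>z. f z - h z) \<le> L2_norm M (\<lambda>z. f z - g z) + L2_norm M (\<lambda>z. g z - h z)"
proof (rule power2_le_imp_le)
  define u v where "u = (\<lambda>z. f z - g z)" and "v = (\<lambda>z. g z - h z)"
  have uv: "u \<in> L2 M" "v \<in> L2 M"
    using assms by (auto simp: u_def v_def L2_diff)
  have "(L2_norm M (\<lambda>z. u z - (-1) * v z))\<^sup>2
      \<le> (L2_norm M u)\<^sup>2 + 2 * (L2_norm M u * L2_norm M v) + (L2_norm M v)\<^sup>2"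
    unfolding L2_norm_diff_scale[OF uv]
    using complex_Re_le_cmod[of "L2_inner M u v"] L2_Cauchy_Schwarz[OF uv] by simp
  moreover have "(\<lambda>z. u z - (-1) * v z) = (\<lambda>z. f z - h z)"
    by (simp add: u_def v_def)
  ultimately have "(L2_norm M (\<lambda>z. f z - h z))\<^sup>2 \<le> (L2_norm M u + L2_norm M v)\<^sup>2"
    by (simp add: power2_sum mult.assoc)
  then show "(L2_norm M (\<lambda>z. f z - h z))\<^sup>2 \<le>
      (L2_norm M (\<lambda>z. f z - g z) + L2_norm M (\<lambda>z. g z - h z))\<^sup>2"
    by (simp add: u_def v_def)
qed simp

lemma L2_inner_tendsto:
  assumes X: "L2_tendsto M X f F" and g: "g \<in> L2 M"
  shows "((\<lambda>i. L2_inner M (X i) g) \<longlongrightarrow> L2_inner M f g) F"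
proof -
  have f: "f \<in> L2 M" and ev: "\<forall>\<^sub>F i in F. X i \<in> L2 M"
    and lim: "((\<lambda>i. L2_norm M (\<lambda>z. X i z - f z)) \<longlongrightarrow> 0) F"
    using X by (auto simp: L2_tendsto_def)
  have "\<forall>\<^sub>F i in F. norm (L2_inner M (X i) g - L2_inner M f g)
      \<le> L2_norm M (\<lambda>z. X i z - f z) * L2_norm M g"
    using ev
  proof eventually_elim
    case (elim i)
    then show ?case
      using L2_Cauchy_Schwarz[OF L2_diff[OF elim f] g] by (simp add: L2_inner_diff_left f g)
  qed
  moreover have "((\<lambda>i. L2_norm M (\<lambda>z. X i z - f z) * L2_norm M g) \<longlongrightarrow> 0) F"
    using tendsto_mult_right[OF lim, of "L2_norm M g"] by simp
  ultimately have "((\<lambda>i. L2_inner M (X i) g - L2_inner M f g) \<longlongrightarrow> 0) F"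
    by (rule Lim_null_comparison)
  then show ?thesis
    by (simp add: LIM_zero_iff)
qed

lemma L2_inner_closure_eq_0:
  assumes A: "A \<subseteq> L2 M" and x: "x \<in> L2_closure M A" and g: "g \<in> L2 M"
    and orth: "\<And>a. a \<in> A \<Longrightarrow> L2_inner M a g = 0"
  shows "L2_inner M x g = 0"
proof -
  have xL: "x \<in> L2 M"
    using x by (auto simp: L2_closure_def)
  have *: "cmod (L2_inner M x g) \<le> \<epsilon> * L2_norm M g" if \<epsilon>: "\<epsilon> > 0" for \<epsilon>
  proof -
    obtain a where a: "a \<in> A" "L2_norm M (\<lambda>z. x z - a z) < \<epsilon>"
      using x \<epsilon> by (auto simp: L2_closure_def)
    have aL: "a \<in> L2 M" using a A by auto
    have "cmod (L2_inner M x g) = cmod (L2_inner M (\<lambda>z. x z - a z) g)"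
      using orth[OF a(1)] by (simp add: L2_inner_diff_left[OF xL aL g])
    also have "\<dots> \<le> L2_norm M (\<lambda>z. x z - a z) * L2_norm M g"
      by (intro L2_Cauchy_Schwarz L2_diff xL aL g)
    also have "\<dots> \<le> \<epsilon> * L2_norm M g"
      using a by (intro mult_right_mono) auto
    finally show ?thesis .
  qed
  have "cmod (L2_inner M x g) \<le> 0"
  proof (rule field_le_epsilon)
    fix e :: real assume "e > 0"
    then have "cmod (L2_inner M x g) \<le> e / (1 + L2_norm M g) * L2_norm M g"
      using L2_norm_nonneg[of M g] by (intro *) (auto intro!: divide_pos_pos add_pos_nonneg)
    also have "\<dots> \<le> e"
      using \<open>e > 0\<close> add_pos_nonneg[OF zero_less_one L2_norm_nonneg[of M g]]
      by (simp add: pos_divide_le_eq)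
    finally show "cmod (L2_inner M x g) \<le> 0 + e" by simp
  qed
  then show ?thesis by simp
qed

section \<open>Completeness and orthogonal projection\<close>

lemma nn_integral_L2_norm:
  assumes "f \<in> L2 M"
  shows "(\<integral>\<^sup>+z. ennreal ((cmod (f z))\<^sup>2) \<partial>M) = ennreal ((L2_norm M f)\<^sup>2)"
  using assms unfolding L2_norm_power2 by (intro nn_integral_eq_integral) (auto simp: L2_def)

lemma L2_norm_leI:
  assumes [measurable]: "f \<in> borel_measurable M"
    and le: "(\<integral>\<^sup>+z. ennreal ((cmod (f z))\<^sup>2) \<partial>M) \<le> ennreal (e\<^sup>2)" and "e \<ge> 0"
  shows "f \<in> L2 M" "L2_norm M f \<le> e"
proof -
  show f: "f \<in> L2 M"
    unfolding L2_def using le by (auto simp: integrable_iff_bounded intro: le_less_trans)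
  have "(L2_norm M f)\<^sup>2 \<le> e\<^sup>2"
    using le unfolding nn_integral_L2_norm[OF f] by simp
  then show "L2_norm M f \<le> e"
    using \<open>e \<ge> 0\<close> by (rule power2_le_imp_le)
qed

text \<open>
  The increments satisfy \<open>\<bar>d\<^sub>k\<bar> \<le> 2\<^bsup>-k\<^esup> + 2\<^sup>k \<bar>d\<^sub>k\<bar>\<^sup>2\<close>, and the second terms have a summable sequence of
  integrals. The increments are thus almost everywhere absolutely summable, on measure spaces of
  infinite total mass as well.
\<close>

lemma AE_convergent_of_fast_L2:
  fixes Y :: "nat \<Rightarrow> 'a \<Rightarrow> complex"
  assumes Y: "\<And>k. Y k \<in> L2 M"
    and fast: "\<And>k. L2_norm M (\<lambda>z. Y (Suc k) z - Y k z) \<le> (1/2) ^ k"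
  shows "AE z in M. convergent (\<lambda>k. Y k z)"
proof -
  have [measurable]: "Y k \<in> borel_measurable M" for k
    using Y[of k] by (auto simp: L2_def)
  define d where "d k z = cmod (Y (Suc k) z - Y k z)" for k z
  have [measurable]: "d k \<in> borel_measurable M" for k
    unfolding d_def by measurable
  have "(\<integral>\<^sup>+z. (\<Sum>k. ennreal (2 ^ k * (d k z)\<^sup>2)) \<partial>M) =
      (\<Sum>k. \<integral>\<^sup>+z. ennreal (2 ^ k * (d k z)\<^sup>2) \<partial>M)"
    by (intro nn_integral_suminf) measurable
  also have "\<dots> \<le> (\<Sum>k. ennreal ((1/2) ^ k))"
  proof (intro suminf_le)
    fix k
    have "(\<integral>\<^sup>+z. ennreal (2 ^ k * (d k z)\<^sup>2) \<partial>M) = ennreal (2 ^ k * (L2_norm M (\<lambda>z. Y (Suc k) z - Y k z))\<^sup>2)"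
      by (simp add: ennreal_mult nn_integral_cmult d_def nn_integral_L2_norm L2_diff Y)
    also have "\<dots> \<le> ennreal (2 ^ k * ((1/2) ^ k)\<^sup>2)"
      using fast[of k] by (intro ennreal_leI mult_left_mono power_mono) auto
    also have "\<dots> = ennreal ((1/2) ^ k)"
      by (simp add: power2_eq_square field_simps)
    finally show "(\<integral>\<^sup>+z. ennreal (2 ^ k * (d k z)\<^sup>2) \<partial>M) \<le> ennreal ((1/2) ^ k)" .
  qed auto
  also have "\<dots> = ennreal (\<Sum>k. (1/2) ^ k)"
    by (intro suminf_ennreal2) (auto intro: summable_geometric)
  also have "\<dots> < \<infinity>" by simp
  finally have "(\<integral>\<^sup>+z. (\<Sum>k. ennreal (2 ^ k * (d k z)\<^sup>2)) \<partial>M) \<noteq> \<infinity>"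
    by simp
  then have "AE z in M. (\<Sum>k. ennreal (2 ^ k * (d k z)\<^sup>2)) \<noteq> \<infinity>"
    by (intro nn_integral_noteq_infinite) auto
  then show ?thesis
  proof eventually_elim
    case (elim z)
    then have "summable (\<lambda>k. 2 ^ k * (d k z)\<^sup>2)"
      by (intro summable_suminf_not_top) (auto simp: top_unique)
    then have maj: "summable (\<lambda>k. (1/2) ^ k + 2 ^ k * (d k z)\<^sup>2)"
      by (intro summable_add) (auto intro: summable_geometric)
    have bound: "norm (d k z) \<le> (1/2) ^ k + 2 ^ k * (d k z)\<^sup>2" for k
    proof -
      have "0 \<le> (1 - 2 ^ k * d k z)\<^sup>2" by simp
      then have "2 * (2 ^ k * d k z) \<le> 1 + (2 ^ k)\<^sup>2 * (d k z)\<^sup>2"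
        by (simp add: power2_diff power_mult_distrib)
      moreover have "0 \<le> 2 ^ k * d k z" by (simp add: d_def)
      ultimately have "2 ^ k * d k z \<le> 1 + (2 ^ k)\<^sup>2 * (d k z)\<^sup>2" by linarith
      then show ?thesis
        by (simp add: field_simps power2_eq_square d_def)
    qed
    have "summable (\<lambda>k. d k z)"
      by (rule summable_comparison_test'[OF maj, of 0]) (rule bound)
    then have "summable (\<lambda>k. norm (Y (Suc k) z - Y k z))"
      by (simp add: d_def)
    then have "summable (\<lambda>k. Y (Suc k) z - Y k z)"
      by (rule summable_norm_cancel)
    then have "convergent (\<lambda>n. \<Sum>k<n. Y (Suc k) z - Y k z)"
      by (simp add: summable_iff_convergent)
    then have "convergent (\<lambda>n. Y n z - Y 0 z)"
      by (simp add: sum_lessThan_telescope[of "\<lambda>k. Y k z"])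
    then show ?case
      using convergent_add[OF _ convergent_const[of "Y 0 z"]] by fastforce
  qed
qed

text \<open>
  The Riesz--Fischer theorem: a rapidly converging subsequence has a pointwise limit by
  \<open>AE_convergent_of_fast_L2\<close>, and Fatou's lemma turns it into a limit of the whole sequence in norm.
\<close>

lemma L2_complete:
  fixes X :: "nat \<Rightarrow> 'a \<Rightarrow> complex"
  assumes X: "\<And>n. X n \<in> L2 M"
    and Cauchy: "\<And>e. e > 0 \<Longrightarrow> \<exists>N. \<forall>m\<ge>N. \<forall>n\<ge>N. L2_norm M (\<lambda>z. X m z - X n z) < e"
  obtains f where "L2_tendsto M X f sequentially"
proof -
  have [measurable]: "X n \<in> borel_measurable M" for n
    using X[of n] by (auto simp: L2_def)
  obtain N where N: "\<And>k m n. m \<ge> N k \<Longrightarrow> n \<ge> N k \<Longrightarrow> L2_norm M (\<lambda>z. X m z - X n z) < (1/2) ^ k"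
    using Cauchy[of "(1/2) ^ k" for k] by (metis half_gt_zero_iff zero_less_one zero_less_power)
  \<comment> \<open>Any indices with \<open>s k \<ge> N k\<close> and \<open>s (Suc k) \<ge> N k\<close> that tend to infinity.\<close>
  define s where "s k = k + (\<Sum>i\<le>k. N i)" for k
  have sN: "s k \<ge> N k" "s (Suc k) \<ge> N k" "s k \<ge> k" for k
  proof -
    have "N k \<le> (\<Sum>i\<le>k. N i)"
      by (intro member_le_sum) auto
    then show "s k \<ge> N k" "s (Suc k) \<ge> N k" "s k \<ge> k"
      by (auto simp: s_def)
  qed
  define f where "f z = lim (\<lambda>k. X (s k) z)" for z
  have [measurable]: "f \<in> borel_measurable M"
    unfolding f_def by measurable
  have "AE z in M. convergent (\<lambda>k. X (s k) z)"
    using sN N by (intro AE_convergent_of_fast_L2 X less_imp_le) auto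
  then have lim: "AE z in M. (\<lambda>k. X (s k) z) \<longlonglongrightarrow> f z"
    by (simp add: f_def convergent_LIMSEQ_iff)
  have close: "\<exists>n0. \<forall>n\<ge>n0. (\<lambda>z. f z - X n z) \<in> L2 M \<and> L2_norm M (\<lambda>z. f z - X n z) \<le> e"
    if e: "e > 0" for e
  proof -
    obtain n0 where n0: "\<And>m n. m \<ge> n0 \<Longrightarrow> n \<ge> n0 \<Longrightarrow> L2_norm M (\<lambda>z. X m z - X n z) < e"
      using Cauchy[OF e] by blast
    have "(\<lambda>z. f z - X n z) \<in> L2 M \<and> L2_norm M (\<lambda>z. f z - X n z) \<le> e" if n: "n \<ge> n0" for n
    proof -
      have "(\<integral>\<^sup>+z. ennreal ((cmod (f z - X n z))\<^sup>2) \<partial>M) =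
          (\<integral>\<^sup>+z. liminf (\<lambda>k. ennreal ((cmod (X (s k) z - X n z))\<^sup>2)) \<partial>M)"
      proof (intro nn_integral_cong_AE, use lim in eventually_elim)
        case (elim z)
        then have "(\<lambda>k. ennreal ((cmod (X (s k) z - X n z))\<^sup>2)) \<longlonglongrightarrow> ennreal ((cmod (f z - X n z))\<^sup>2)"
          by (intro tendsto_intros)
        then show ?case
          by (intro lim_imp_Liminf[symmetric]) auto
      qed
      also have "\<dots> \<le> liminf (\<lambda>k. \<integral>\<^sup>+z. ennreal ((cmod (X (s k) z - X n z))\<^sup>2) \<partial>M)"
        by (intro nn_integral_liminf) measurable
      also have "\<dots> \<le> ennreal (e\<^sup>2)"
      proof (rule Liminf_le)
        show "\<forall>\<^sub>F k in sequentially. (\<integral>\<^sup>+z. ennreal ((cmod (X (s k) z - X n z))\<^sup>2) \<partial>M) \<le> ennreal (e\<^sup>2)"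
          using eventually_ge_at_top[of n0]
        proof eventually_elim
          case (elim k)
          then have "L2_norm M (\<lambda>z. X (s k) z - X n z) < e"
            using sN(3)[of k] by (intro n0 n) auto
          then have "(L2_norm M (\<lambda>z. X (s k) z - X n z))\<^sup>2 \<le> e\<^sup>2"
            by (intro power_mono) auto
          then show ?case
            by (subst nn_integral_L2_norm) (auto intro: L2_diff X ennreal_leI)
        qed
      qed simp
      finally show ?thesis
        using L2_norm_leI[of "\<lambda>z. f z - X n z" M e] e by auto
    qed
    then show ?thesis by blast
  qed
  have "f \<in> L2 M"
  proof -
    obtain n where "(\<lambda>z. f z - X n z) \<in> L2 M"
      using close[of 1] by auto
    from L2_add[OF this X[of n]] show ?thesis by simp
  qed
  moreover have "(\<lambda>n. L2_norm M (\<lambda>z. X n z - f z)) \<longlonglongrightarrow> 0"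
  proof (rule LIMSEQ_I)
    fix r :: real assume "r > 0"
    then obtain n0 where "\<forall>n\<ge>n0. L2_norm M (\<lambda>z. f z - X n z) \<le> r / 2"
      using close[of "r / 2"] by auto
    then show "\<exists>n0. \<forall>n\<ge>n0. norm (L2_norm M (\<lambda>z. X n z - f z) - 0) < r"
      using \<open>r > 0\<close> L2_norm_minus_commute[of M f] by (intro exI[of _ n0]) (fastforce simp: le_less_trans)
  qed
  ultimately show thesis
    using X by (intro that[of f]) (auto simp: L2_tendsto_def)
qed

text \<open>
  A minimizing sequence for the distance from \<open>x\<close> to \<open>A\<close> is a Cauchy sequence by the parallelogram
  identity. Its limit is the projection: moving it in the direction of an element of \<open>A\<close> does not
  decrease the distance to \<open>x\<close>, which forces orthogonality.
\<close>

lemma L2_projection: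
  assumes A: "A \<subseteq> L2 M" and ne: "A \<noteq> {}"
    and add: "\<And>a b. a \<in> A \<Longrightarrow> b \<in> A \<Longrightarrow> (\<lambda>z. a z + b z) \<in> A"
    and scale: "\<And>c a. a \<in> A \<Longrightarrow> (\<lambda>z. c * a z) \<in> A"
    and x: "x \<in> L2 M"
  obtains p where "p \<in> L2_closure M A" "(\<lambda>z. x z - p z) \<in> L2_orth M A"
proof -
  define d where "d = (INF a\<in>A. L2_norm M (\<lambda>z. x z - a z))"
  have bdd: "bdd_below ((\<lambda>a. L2_norm M (\<lambda>z. x z - a z)) ` A)"
    by (rule bdd_belowI[of _ 0]) auto
  have d_le: "d \<le> L2_norm M (\<lambda>z. x z - a z)" if "a \<in> A" for a
    unfolding d_def using that by (intro cINF_lower bdd)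
  have d0: "d \<ge> 0"
    unfolding d_def using ne by (intro cINF_greatest) auto
  define e where "e n = 1 / real (Suc n)" for n
  have e0: "e n > 0" for n by (simp add: e_def)
  have e_lim: "e \<longlonglongrightarrow> 0"
    unfolding e_def using LIMSEQ_inverse_real_of_nat by (simp add: field_simps)
  have "\<exists>a\<in>A. L2_norm M (\<lambda>z. x z - a z) < d + e n" for n
    using e0[of n] cINF_less_iff[OF ne bdd, of "d + e n"] by (simp add: d_def)
  then obtain a where a: "\<And>n. a n \<in> A" and a_d: "\<And>n. L2_norm M (\<lambda>z. x z - a n z) < d + e n"
    by metis
  have aL: "a n \<in> L2 M" for n using a A by auto
  have gL: "(\<lambda>z. x z - a n z) \<in> L2 M" for n by (intro L2_diff x aL)
  have par: "(L2_norm M (\<lambda>z. a m z - a n z))\<^sup>2 \<le> 2 * (d + e m)\<^sup>2 + 2 * (d + e n)\<^sup>2 - 4 * d\<^sup>2" for m n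
  proof -
    define u v where "u = (\<lambda>z. x z - a m z)" and "v = (\<lambda>z. x z - a n z)"
    have uv: "u \<in> L2 M" "v \<in> L2 M" using gL by (auto simp: u_def v_def)
    \<comment> \<open>The midpoint of two almost optimal elements of \<open>A\<close> is in \<open>A\<close>, hence not closer to \<open>x\<close> than \<open>d\<close>.\<close>
    have mid: "(\<lambda>z. (1/2) * (a m z + a n z)) \<in> A"
      by (intro scale add a)
    have "(L2_norm M (\<lambda>z. u z - (-1) * v z))\<^sup>2 + (L2_norm M (\<lambda>z. u z - 1 * v z))\<^sup>2 =
        2 * (L2_norm M u)\<^sup>2 + 2 * (L2_norm M v)\<^sup>2"
      unfolding L2_norm_diff_scale[OF uv] by simp
    moreover have "(L2_norm M (\<lambda>z. u z - (-1) * v z)) = 2 * L2_norm M (\<lambda>z. x z - (1/2) * (a m z + a n z))"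
    proof -
      have "(\<lambda>z. u z - (-1) * v z) = (\<lambda>z. 2 * (x z - (1/2) * (a m z + a n z)))"
        by (simp add: u_def v_def algebra_simps)
      then show ?thesis
        by (simp only: L2_norm_def norm_mult power_mult_distrib Bochner_Integration.integral_mult_right_zero real_sqrt_mult)
          simp
    qed
    moreover have "L2_norm M (\<lambda>z. u z - 1 * v z) = L2_norm M (\<lambda>z. a m z - a n z)"
      by (subst L2_norm_minus_commute) (simp add: u_def v_def algebra_simps)
    moreover have "d\<^sup>2 \<le> (L2_norm M (\<lambda>z. x z - (1/2) * (a m z + a n z)))\<^sup>2"
      by (intro power_mono d_le mid d0)
    moreover have "(L2_norm M u)\<^sup>2 \<le> (d + e m)\<^sup>2" "(L2_norm M v)\<^sup>2 \<le> (d + e n)\<^sup>2"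
      using a_d less_imp_le by (auto simp: u_def v_def intro!: power_mono)
    ultimately show ?thesis by (simp add: power_mult_distrib)
  qed
  obtain p where p: "L2_tendsto M a p sequentially"
  proof (rule L2_complete[of a M, OF aL])
    fix r :: real assume r: "r > 0"
    have "(\<lambda>N. 4 * ((d + e N)\<^sup>2 - d\<^sup>2)) \<longlonglongrightarrow> 4 * ((d + 0)\<^sup>2 - d\<^sup>2)"
      by (intro tendsto_intros e_lim)
    then have "\<forall>\<^sub>F N in sequentially. 4 * ((d + e N)\<^sup>2 - d\<^sup>2) < r\<^sup>2"
      using r by (intro order_tendstoD(2)) auto
    then obtain N where N: "4 * ((d + e N)\<^sup>2 - d\<^sup>2) < r\<^sup>2"
      by (auto simp: eventually_sequentially)
    have "L2_norm M (\<lambda>z. a m z - a n z) < r" if "m \<ge> N" "n \<ge> N" for m n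
    proof (rule power2_less_imp_less)
      have "(d + e k)\<^sup>2 \<le> (d + e N)\<^sup>2" if "k \<ge> N" for k
        using that d0 e0[of k] by (intro power_mono) (auto simp: e_def field_simps)
      from this[OF that(1)] this[OF that(2)] par[of m n] N
      show "(L2_norm M (\<lambda>z. a m z - a n z))\<^sup>2 < r\<^sup>2" by argo
    qed (use r in auto)
    then show "\<exists>N. \<forall>m\<ge>N. \<forall>n\<ge>N. L2_norm M (\<lambda>z. a m z - a n z) < r"
      by blast
  qed
  have pL: "p \<in> L2 M" and lim: "(\<lambda>n. L2_norm M (\<lambda>z. a n z - p z)) \<longlonglongrightarrow> 0"
    using p by (auto simp: L2_tendsto_def)
  have "p \<in> L2_closure M A"
    unfolding L2_closure_def
  proof (intro CollectI conjI pL allI impI)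
    fix \<epsilon> :: real assume "\<epsilon> > 0"
    then have "\<forall>\<^sub>F n in sequentially. L2_norm M (\<lambda>z. a n z - p z) < \<epsilon>"
      using lim by (intro order_tendstoD(2)) auto
    then show "\<exists>g\<in>A. L2_norm M (\<lambda>z. p z - g z) < \<epsilon>"
      using a L2_norm_minus_commute[of M p] by (auto simp: eventually_sequentially)
  qed
  moreover have "(\<lambda>z. x z - p z) \<in> L2_orth M A"
    unfolding L2_orth_def
  proof (intro CollectI conjI ballI L2_diff x pL)
    fix b assume b: "b \<in> A"
    then have bL: "b \<in> L2 M" using A by auto
    define \<alpha> where "\<alpha> = L2_inner M (\<lambda>z. x z - p z) b"
    have lim_inner: "(\<lambda>n. L2_inner M (\<lambda>z. x z - a n z) b) \<longlonglongrightarrow> \<alpha>"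
      unfolding \<alpha>_def L2_inner_diff_left[OF x aL bL] L2_inner_diff_left[OF x pL bL]
      by (intro tendsto_intros L2_inner_tendsto[OF p bL])
    have var: "2 * Re (cnj c * \<alpha>) \<le> (cmod c)\<^sup>2 * (L2_norm M b)\<^sup>2" for c
    proof -
      have "d\<^sup>2 \<le> (d + e n)\<^sup>2 - 2 * Re (cnj c * L2_inner M (\<lambda>z. x z - a n z) b)
          + (cmod c)\<^sup>2 * (L2_norm M b)\<^sup>2" for n
      proof -
        have "(\<lambda>z. a n z + c * b z) \<in> A"
          by (intro add scale a b)
        from d_le[OF this] have "d \<le> L2_norm M (\<lambda>z. (x z - a n z) - c * b z)"
          by (simp add: algebra_simps)
        then have "d\<^sup>2 \<le> (L2_norm M (\<lambda>z. (x z - a n z) - c * b z))\<^sup>2"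
          by (intro power_mono d0)
        moreover have "(L2_norm M (\<lambda>z. x z - a n z))\<^sup>2 \<le> (d + e n)\<^sup>2"
          using a_d less_imp_le by (auto intro!: power_mono)
        ultimately show ?thesis
          unfolding L2_norm_diff_scale[OF gL bL] by linarith
      qed
      moreover have "(\<lambda>n. (d + e n)\<^sup>2 - 2 * Re (cnj c * L2_inner M (\<lambda>z. x z - a n z) b)
          + (cmod c)\<^sup>2 * (L2_norm M b)\<^sup>2) \<longlonglongrightarrow>
          (d + 0)\<^sup>2 - 2 * Re (cnj c * \<alpha>) + (cmod c)\<^sup>2 * (L2_norm M b)\<^sup>2"
        by (intro tendsto_intros e_lim lim_inner)
      ultimately have "d\<^sup>2 \<le> (d + 0)\<^sup>2 - 2 * Re (cnj c * \<alpha>) + (cmod c)\<^sup>2 * (L2_norm M b)\<^sup>2"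
        by (intro LIMSEQ_le_const) auto
      then show ?thesis by simp
    qed
    define B where "B = (L2_norm M b)\<^sup>2"
    \<comment> \<open>Insert \<open>c = t \<alpha>\<close> in \<open>var\<close>; any \<open>t > 0\<close> with \<open>t \<parallel>b\<parallel>\<^sup>2 < 2\<close> gives \<open>\<alpha> = 0\<close>.\<close>
    define t where "t = 1 / (1 + B)"
    have B: "B \<ge> 0" by (simp add: B_def)
    have "cnj \<alpha> * \<alpha> = of_real ((cmod \<alpha>)\<^sup>2)"
      by (metis complex_norm_square mult.commute)
    then have "Re (cnj (of_real t * \<alpha>) * \<alpha>) = t * (cmod \<alpha>)\<^sup>2"
      by (simp add: mult.assoc del: of_real_power)
    then have "2 * (t * (cmod \<alpha>)\<^sup>2) \<le> t\<^sup>2 * (cmod \<alpha>)\<^sup>2 * B"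
      using var[of "of_real t * \<alpha>"] by (simp add: norm_mult power_mult_distrib B_def)
    then have "(cmod \<alpha>)\<^sup>2 * (t * (2 - t * B)) \<le> 0"
      by (simp add: algebra_simps power2_eq_square)
    moreover have "t * (2 - t * B) > 0"
      using B by (auto simp: t_def field_simps add_pos_nonneg)
    ultimately have "(cmod \<alpha>)\<^sup>2 \<le> 0"
      by (metis mult_le_0_iff not_less)
    then show "L2_inner M (\<lambda>z. x z - p z) b = 0"
      by (simp add: \<alpha>_def)
  qed
  ultimately show thesis by (rule that)
qed

text \<open>
  The component \<open>g\<close> of \<open>x\<close> orthogonal to \<open>A\<close> satisfies \<open>\<parallel>g\<parallel>\<^sup>2 = \<langle>x, g\<rangle>\<close>, so \<open>x\<close> is in the closure as soon as
  this inner product vanishes. When \<open>x\<close> is orthogonal to everything orthogonal to \<open>A\<close>, this says that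
  the double orthogonal complement of \<open>A\<close> is its closure. For density in a subspace \<open>H\<close> containing \<open>A\<close>
  one also needs that \<open>g\<close> stays in \<open>H\<close>, hence the description of \<open>g\<close> in the last hypothesis.
\<close>

lemma L2_closureI_orth:
  assumes A: "A \<subseteq> L2 M" and ne: "A \<noteq> {}"
    and add: "\<And>a b. a \<in> A \<Longrightarrow> b \<in> A \<Longrightarrow> (\<lambda>z. a z + b z) \<in> A"
    and scale: "\<And>c a. a \<in> A \<Longrightarrow> (\<lambda>z. c * a z) \<in> A"
    and x: "x \<in> L2 M"
    and orth: "\<And>p g. p \<in> L2_closure M A \<Longrightarrow> g \<in> L2_orth M A \<Longrightarrow> g = (\<lambda>z. x z - p z) \<Longrightarrow> L2_inner M x g = 0"
  shows "x \<in> L2_closure M A"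
proof -
  obtain p where p: "p \<in> L2_closure M A" and g: "(\<lambda>z. x z - p z) \<in> L2_orth M A"
    using L2_projection[OF A ne add scale x] by blast
  define g where "g = (\<lambda>z. x z - p z)"
  have pL: "p \<in> L2 M" using p by (auto simp: L2_closure_def)
  have gL: "g \<in> L2 M" and go: "\<And>a. a \<in> A \<Longrightarrow> L2_inner M g a = 0"
    using g by (auto simp: L2_orth_def g_def)
  have "L2_inner M p g = 0"
    by (rule L2_inner_closure_eq_0[OF A p gL]) (subst L2_inner_commute, simp add: go)
  moreover have "L2_inner M x g = 0"
    using orth[OF p g refl] by (simp add: g_def)
  ultimately have "L2_inner M g g = 0"
    using L2_inner_diff_left[OF x pL gL] by (simp add: g_def)
  then have g0: "L2_norm M (\<lambda>z. x z - p z) = 0"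
    by (simp add: L2_inner_self g_def)
  show ?thesis
    unfolding L2_closure_def
  proof (intro CollectI conjI x allI impI)
    fix \<epsilon> :: real assume "\<epsilon> > 0"
    then obtain a where a: "a \<in> A" "L2_norm M (\<lambda>z. p z - a z) < \<epsilon>"
      using p by (auto simp: L2_closure_def)
    then show "\<exists>a\<in>A. L2_norm M (\<lambda>z. x z - a z) < \<epsilon>"
      using L2_norm_triangle[OF x pL, of a] A g0 by (intro bexI[of _ a]) auto
  qed
qed

lemma L2_orth_add:
  assumes "f \<in> L2_orth M A" "g \<in> L2_orth M A" "A \<subseteq> L2 M"
  shows "(\<lambda>z. f z + g z) \<in> L2_orth M A"
  unfolding L2_orth_def
proof (intro CollectI conjI ballI)
  have fg: "f \<in> L2 M" "g \<in> L2 M" using assms by (auto simp: L2_orth_def)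
  show "(\<lambda>z. f z + g z) \<in> L2 M" by (intro L2_add fg)
  fix a assume a: "a \<in> A"
  then have "a \<in> L2 M" using assms(3) by blast
  then have "L2_inner M (\<lambda>z. f z + g z) a = L2_inner M f a + L2_inner M g a"
    using fg by (simp add: L2_inner_def distrib_right L2_integrable_inner)
  then show "L2_inner M (\<lambda>z. f z + g z) a = 0"
    using assms(1,2) a by (simp add: L2_orth_def)
qed

lemma L2_orth_scale: "f \<in> L2_orth M A \<Longrightarrow> (\<lambda>z. c * f z) \<in> L2_orth M A"
  by (auto simp: L2_orth_def L2_scale L2_inner_scale_left)

text \<open>
  Orthogonality passes to limits along arbitrary filters; the functional calculus uses both
  sequences and the filter \<open>at_left 1\<close>.
\<close>

lemma L2_orth_tendsto:
  assumes X: "L2_tendsto M X g F" and ev: "\<forall>\<^sub>F i in F. X i \<in> L2_orth M A"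
    and A: "A \<subseteq> L2 M" and F: "F \<noteq> bot"
  shows "g \<in> L2_orth M A"
  unfolding L2_orth_def
proof (intro CollectI conjI ballI)
  show "g \<in> L2 M" using X by (simp add: L2_tendsto_def)
  fix a assume a: "a \<in> A"
  have "\<forall>\<^sub>F i in F. L2_inner M (X i) a = 0"
    using ev by eventually_elim (use a in \<open>auto simp: L2_orth_def\<close>)
  then have "((\<lambda>i. L2_inner M (X i) a) \<longlongrightarrow> 0) F"
    by (rule tendsto_eventually)
  moreover have "((\<lambda>i. L2_inner M (X i) a) \<longlongrightarrow> L2_inner M g a) F"
    using a A by (intro L2_inner_tendsto[OF X]) auto
  ultimately show "L2_inner M g a = 0"
    using tendsto_unique[OF F] by metis
qed

lemma L2_subset_closure:
  assumes "A \<subseteq> L2 M"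
  shows "A \<subseteq> L2_closure M A"
proof
  fix a assume a: "a \<in> A"
  have "L2_norm M (\<lambda>z. a z - a z) = 0"
    by (simp add: L2_norm_def)
  with a have "\<exists>g\<in>A. L2_norm M (\<lambda>z. a z - g z) < \<epsilon>" if "\<epsilon> > 0" for \<epsilon>
    using that by (intro bexI[of _ a]) simp_all
  then show "a \<in> L2_closure M A"
    using a assms by (auto simp: L2_closure_def)
qed

lemma L2_inner_eq_0_commute: "L2_inner M f g = 0 \<longleftrightarrow> L2_inner M g f = 0"
  using L2_inner_commute[of M f g] by simp

lemma L2_orth_closure:
  assumes "A \<subseteq> L2 M"
  shows "L2_orth M (L2_closure M A) = L2_orth M A"
proof
  show "L2_orth M (L2_closure M A) \<subseteq> L2_orth M A"
    using L2_subset_closure[OF assms] by (auto simp: L2_orth_def)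
  show "L2_orth M A \<subseteq> L2_orth M (L2_closure M A)"
    using L2_inner_closure_eq_0[OF assms] L2_inner_eq_0_commute unfolding L2_orth_def by blast
qed

section \<open>Integration over the circle\<close>

lemma space_circle_measure: "space circle_measure = sphere 0 1"
  by (simp add: circle_measure_def space_restrict_space)

lemma circle_measurable_continuous:
  assumes "continuous_on (sphere 0 1) (f :: complex \<Rightarrow> complex)"
  shows "f \<in> borel_measurable circle_measure"
  unfolding circle_measure_def measurable_distr_eq1
  by (rule borel_measurable_continuous_on_restrict[OF assms])

lemma circle_integrable_continuous:
  assumes "continuous_on (sphere 0 1) (f :: complex \<Rightarrow> complex)"
  shows "integrable circle_measure f"
proof -
  interpret prob_space circle_measure by (rule prob_space_circle_measure)
  have "compact (f ` sphere 0 1)"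
    by (intro compact_continuous_image assms) simp
  then obtain B where "\<And>z. z \<in> sphere 0 1 \<Longrightarrow> cmod (f z) \<le> B"
    by (meson bounded_iff compact_imp_bounded image_eqI)
  then show ?thesis
    by (intro integrable_const_bound[where B = B] AE_I2 circle_measurable_continuous assms)
      (simp add: space_circle_measure)
qed

lemma nn_integral_circle_measure:
  assumes "f \<in> borel_measurable circle_measure"
  shows "(\<integral>\<^sup>+z. f z \<partial>circle_measure) = (\<integral>\<^sup>+t. f (cis t) * indicator {0..<2*pi} t \<partial>lborel) / ennreal (2 * pi)"
proof -
  have "(\<integral>\<^sup>+z. f z \<partial>circle_measure) = (\<integral>\<^sup>+t. f (cis t) \<partial>uniform_measure lborel {0..<2*pi})"
    using assms unfolding circle_measure_def measurable_distr_eq1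
    by (subst nn_integral_distr) auto
  also have "\<dots> = (\<integral>\<^sup>+t. f (cis t) * indicator {0..<2*pi} t \<partial>lborel) / ennreal (2 * pi)"
    using measurable_compose[OF cis_measurable_circle, of f borel] assms
    by (subst nn_integral_uniform_measure) (auto simp: circle_measure_def)
  finally show ?thesis .
qed

lemma circle_measure_point: "{w} \<inter> sphere 0 1 \<in> null_sets circle_measure"
proof -
  \<comment> \<open>The preimage of a point under \<open>cis\<close> is empty or a translate of \<open>2\<pi>\<int>\<close>.\<close>
  have "countable {t. cis t = w}"
  proof (cases "\<exists>s. cis s = w")
    case True
    then obtain s where s: "cis s = w" by blast
    have "{t. cis t = w} \<subseteq> range (\<lambda>n::int. s + 2 * pi * n)"
      using s sin_cos_eq_iff[of _ s] by (auto simp: complex_eq_iff)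
    then show ?thesis
      by (rule countable_subset) auto
  qed auto
  then have null: "{t. cis t = w} \<in> null_sets lborel"
    by (rule countable_imp_null_set_lborel)
  have sets: "{w} \<inter> sphere 0 1 \<in> sets circle_measure"
    unfolding circle_measure_def sets_distr sets_restrict_space
    by (rule image_eqI[where x = "{w}"]) auto
  have "emeasure circle_measure ({w} \<inter> sphere 0 1) =
      (\<integral>\<^sup>+z. indicator ({w} \<inter> sphere 0 1) z \<partial>circle_measure)"
    using sets by simp
  also have "\<dots> = (\<integral>\<^sup>+t. indicator ({w} \<inter> sphere 0 1) (cis t) * indicator {0..<2*pi} t \<partial>lborel) / ennreal (2 * pi)"
    using sets by (intro nn_integral_circle_measure) auto
  also have "(\<integral>\<^sup>+t. indicator ({w} \<inter> sphere 0 1) (cis t) * indicator {0..<2*pi} t \<partial>lborel) = (\<integral>\<^sup>+(t::real). 0 \<partial>lborel)"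
    using AE_not_in[OF null] by (intro nn_integral_cong_AE) (auto simp: indicator_def elim!: eventually_mono)
  finally show ?thesis
    using sets by auto
qed

lemma circle_integral_cis:
  assumes "continuous_on (sphere 0 1) (f :: complex \<Rightarrow> complex)"
  shows "(\<integral>z. f z \<partial>circle_measure) = (\<integral>t. indicator {0..2*pi} t *\<^sub>R f (cis t) \<partial>lborel) / of_real (2 * pi)"
proof -
  have m: "f \<in> borel_measurable circle_measure"
    by (rule circle_measurable_continuous[OF assms])
  have cont: "continuous_on UNIV (\<lambda>t. f (cis t))"
    by (intro continuous_on_compose2[OF assms] continuous_intros) auto
  have [measurable]: "(\<lambda>t. f (cis t)) \<in> borel_measurable lborel"
    using borel_measurable_continuous_onI[OF cont] by simp
  have "(\<integral>z. f z \<partial>circle_measure) = (\<integral>t. f (cis t) \<partial>uniform_measure lborel {0..<2*pi})"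
    using m unfolding circle_measure_def measurable_distr_eq1
    by (subst integral_distr) auto
  also have "uniform_measure lborel {0..<2*pi} =
      density lborel (\<lambda>t. ennreal (indicator {0..<2*pi} t / (2 * pi)))"
    unfolding uniform_measure_def
    by (intro density_cong AE_I2) (auto simp: indicator_def divide_ennreal ennreal_1[symmetric] simp del: ennreal_1)
  also have "(\<integral>t. f (cis t) \<partial>density lborel (\<lambda>t. ennreal (indicator {0..<2*pi} t / (2 * pi)))) =
      (\<integral>t. (indicator {0..<2*pi} t / (2 * pi)) *\<^sub>R f (cis t) \<partial>lborel)"
    by (intro integral_density) auto
  also have "\<dots> = (\<integral>t. (1 / (2*pi)) *\<^sub>R (indicator {0..2*pi} t *\<^sub>R f (cis t)) \<partial>lborel)"
    using AE_lborel_singleton[of "2*pi"]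
    by (intro integral_cong_AE) (auto simp: indicator_def elim!: eventually_mono)
  also have "\<dots> = (1 / (2*pi)) *\<^sub>R (\<integral>t. indicator {0..2*pi} t *\<^sub>R f (cis t) \<partial>lborel)"
    by (rule integral_scaleR_right)
  finally show ?thesis
    by (simp add: scaleR_conv_of_real)
qed

text \<open>
  For \<open>m \<noteq> n\<close> the integrand is \<open>cis (k t)\<close> with an integer \<open>k \<noteq> 0\<close>, whose primitive is periodic.
\<close>

lemma circle_integral_monomials:
  "(\<integral>z. z ^ m * cnj z ^ n \<partial>circle_measure) = (if m = n then 1 else 0)"
proof -
  interpret prob_space circle_measure by (rule prob_space_circle_measure)
  show ?thesis
  proof (cases "m = n")
    case True
    have "(\<integral>z. z ^ m * cnj z ^ n \<partial>circle_measure) = (\<integral>z. 1 \<partial>circle_measure)"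
    proof (rule Bochner_Integration.integral_cong)
      fix z assume "z \<in> space circle_measure"
      then have "z * cnj z = 1"
        by (simp add: space_circle_measure complex_norm_square[symmetric])
      then show "z ^ m * cnj z ^ n = 1"
        using True by (simp flip: power_mult_distrib)
    qed simp
    then show ?thesis using True by (simp add: prob_space)
  next
    case False
    define k where "k = real m - real n"
    have k: "k \<noteq> 0" using False by (simp add: k_def)
    have eq: "cis t ^ m * cnj (cis t) ^ n = cis (k * t)" for t
    proof -
      have "real m * t + real n * - t = k * t"
        by (simp add: k_def algebra_simps)
      then show ?thesis
        by (simp only: cis_cnj Complex.DeMoivre cis_mult)
    qed
    define F where "F t = cis (k * t) / (\<i> * k)" for t
    have "(\<integral>z. z ^ m * cnj z ^ n \<partial>circle_measure) =
        (\<integral>t. indicator {0..2*pi} t *\<^sub>R (cis (k * t)) \<partial>lborel) / of_real (2 * pi)"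
      by (subst circle_integral_cis) (auto intro!: continuous_intros simp: eq)
    also have "(\<integral>t. indicator {0..2*pi} t *\<^sub>R (cis (k * t)) \<partial>lborel) = F (2 * pi) - F 0"
    proof (rule integral_FTC_Icc)
      show "(F has_vector_derivative cis (k * t)) (at t within {0..2*pi})" for t
      proof -
        have "((\<lambda>z. exp (\<i> * k * z) / (\<i> * k)) has_field_derivative exp (\<i> * k * of_real t)) (at (of_real t))"
          using k by (auto intro!: derivative_eq_intros)
        from has_vector_derivative_real_field[OF this] show ?thesis
          unfolding F_def[abs_def] cis_conv_exp by (simp add: mult.assoc)
      qed
      show "continuous_on {0..2*pi} (\<lambda>t. cis (k * t))"
        by (intro continuous_intros)
    qed simp
    also have "F (2 * pi) = F 0"
    proof -
      have "cis (k * (2 * pi)) = cis (real m * (2 * pi)) * cnj (cis (real n * (2 * pi)))"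
        by (simp add: cis_cnj cis_mult k_def algebra_simps)
      also have "\<dots> = 1"
        by (simp only: Complex.DeMoivre[symmetric]) simp
      finally show ?thesis by (simp add: F_def)
    qed
    finally show ?thesis using False by simp
  qed
qed

text \<open>
  Integration term by term extracts the Taylor coefficients, which is Cauchy's formula on a circle
  inside the disc of convergence.
\<close>

lemma circle_integral_power_series:
  fixes c :: "nat \<Rightarrow> complex"
  assumes c: "summable (\<lambda>m. cmod (c m))"
    and f: "\<And>z. z \<in> sphere 0 1 \<Longrightarrow> (\<lambda>m. c m * z ^ m) sums f z"
  shows "(\<integral>z. f z * cnj z ^ n \<partial>circle_measure) = c n"
    "integrable circle_measure (\<lambda>z. f z * cnj z ^ n)"
proof -
  interpret prob_space circle_measure by (rule prob_space_circle_measure)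
  define u where "u m z = c m * z ^ m * cnj z ^ n" for m z
  have nu: "norm (u m z) = cmod (c m)" if "z \<in> sphere 0 1" for m z
    using that by (simp add: u_def norm_mult norm_power)
  have int: "integrable circle_measure (u m)" for m
    unfolding u_def by (intro circle_integrable_continuous continuous_intros)
  have norm_int: "(\<integral>z. norm (u m z) \<partial>circle_measure) = cmod (c m)" for m
  proof -
    have "(\<integral>z. norm (u m z) \<partial>circle_measure) = (\<integral>z. cmod (c m) \<partial>circle_measure)"
      by (intro Bochner_Integration.integral_cong refl) (simp add: space_circle_measure nu)
    then show ?thesis by (simp add: prob_space)
  qed
  have sumf: "(\<Sum>m. u m z) = f z * cnj z ^ n" if "z \<in> sphere 0 1" for z
    using sums_mult2[OF f[OF that], of "cnj z ^ n"] by (simp add: u_def sums_iff)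
  have "AE z in circle_measure. summable (\<lambda>m. norm (u m z))"
    using c by (intro AE_I2) (simp add: space_circle_measure nu)
  note * = int this c[folded norm_int]
  have eq: "(\<integral>z. f z * cnj z ^ n \<partial>circle_measure) = (\<integral>z. (\<Sum>m. u m z) \<partial>circle_measure)"
    by (intro Bochner_Integration.integral_cong refl) (simp add: space_circle_measure sumf)
  also have "\<dots> = (\<Sum>m. \<integral>z. u m z \<partial>circle_measure)"
    by (rule integral_suminf[OF *])
  also have "\<dots> = (\<Sum>m. if m = n then c m else 0)"
    by (simp add: u_def mult.assoc circle_integral_monomials if_distrib cong: if_cong)
  also have "\<dots> = c n"
    using sums_single[of n c] by (simp add: sums_iff)
  finally show "(\<integral>z. f z * cnj z ^ n \<partial>circle_measure) = c n" .
  have "integrable circle_measure (\<lambda>z. \<Sum>m. u m z)"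
    by (rule integrable_suminf[OF *])
  then show "integrable circle_measure (\<lambda>z. f z * cnj z ^ n)"
    using Bochner_Integration.integrable_cong[OF refl, of circle_measure "\<lambda>z. \<Sum>m. u m z" "\<lambda>z. f z * cnj z ^ n"]
    by (simp add: space_circle_measure sumf)
qed

text \<open>
  The integrand times \<open>1 - \<bar>w\<bar>\<^sup>2\<close> is the real part of \<open>(1 + w z)/(1 - w z) = 1 + 2 \<Sum>\<^sub>m (w z)\<^sup>m\<close>, whose mean is
  its constant coefficient \<open>1\<close>.
\<close>

lemma nn_integral_Poisson_kernel:
  fixes w :: complex
  assumes w: "cmod w < 1"
  shows "(\<integral>\<^sup>+z. ennreal (1 / (cmod (1 - w * z))\<^sup>2) \<partial>circle_measure) = ennreal (1 / (1 - (cmod w)\<^sup>2))"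
proof -
  interpret prob_space circle_measure by (rule prob_space_circle_measure)
  define c where "c m = (if m = 0 then 1 else 2 * w ^ m)" for m :: nat
  define f where "f z = 2 / (1 - w * z) - 1" for z
  have geo: "(\<lambda>m. c m * z ^ m) sums f z" if "z \<in> sphere 0 1" for z
  proof -
    have "cmod (w * z) < 1" using that w by (simp add: norm_mult)
    then have "(\<lambda>m. 2 * (w * z) ^ m) sums (2 * (1 / (1 - w * z)))"
      by (intro sums_mult geometric_sums)
    from sums_diff[OF this sums_single[of 0 "\<lambda>_. 1"]]
    have "(\<lambda>m. 2 * (w * z) ^ m - (if m = 0 then 1 else 0)) sums f z"
      by (simp add: f_def)
    moreover have "2 * (w * z) ^ m - (if m = 0 then 1 else 0) = c m * z ^ m" for m
      by (simp add: c_def power_mult_distrib)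
    ultimately show ?thesis by simp
  qed
  have "summable (\<lambda>m. 2 * cmod w ^ m)"
    using w by (intro summable_mult summable_geometric) simp
  then have "summable (\<lambda>m. cmod (c m))"
    by (rule summable_comparison_test'[where N = 0]) (auto simp: c_def norm_mult norm_power)
  note * = circle_integral_power_series[OF this geo, of 0]
  have pw: "Re (f z) = (1 - (cmod w)\<^sup>2) * (1 / (cmod (1 - w * z))\<^sup>2)" if "z \<in> sphere 0 1" for z
  proof -
    have "cmod (w * z) < 1" using that w by (simp add: norm_mult)
    then have "1 - w * z \<noteq> 0" by auto
    then have "f z = (1 + w * z) / (1 - w * z)"
      by (simp add: f_def field_simps)
    also have "\<dots> = (1 + w * z) * cnj (1 - w * z) / of_real ((cmod (1 - w * z))\<^sup>2)"
      using complex_div_cnj by blast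
    finally have "Re (f z) = Re ((1 + w * z) * cnj (1 - w * z)) / (cmod (1 - w * z))\<^sup>2"
      by (metis Re_divide_of_real)
    moreover have "Re ((1 + w * z) * cnj (1 - w * z)) = 1 - (cmod (w * z))\<^sup>2"
      unfolding cmod_power2 by (simp add: algebra_simps power2_eq_square)
    ultimately show ?thesis using that by (simp add: norm_mult)
  qed
  have w2: "(cmod w)\<^sup>2 < 1" using w by (simp add: abs_square_less_1)
  have int: "integrable circle_measure (\<lambda>z. Re (f z))"
    using *(2) by (intro integrable_Re) simp
  have "(\<integral>\<^sup>+z. ennreal (1 / (cmod (1 - w * z))\<^sup>2) \<partial>circle_measure) =
      (\<integral>\<^sup>+z. ennreal (1 / (1 - (cmod w)\<^sup>2) * Re (f z)) \<partial>circle_measure)"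
    using w2 by (intro nn_integral_cong arg_cong[of _ _ ennreal])
      (simp add: space_circle_measure pw)
  also have "\<dots> = ennreal (\<integral>z. 1 / (1 - (cmod w)\<^sup>2) * Re (f z) \<partial>circle_measure)"
    using int w by (intro nn_integral_eq_integral AE_I2)
      (auto simp: space_circle_measure pw power_le_one intro!: mult_nonneg_nonneg)
  also have "(\<integral>z. 1 / (1 - (cmod w)\<^sup>2) * Re (f z) \<partial>circle_measure) = 1 / (1 - (cmod w)\<^sup>2)"
  proof -
    have "(\<integral>z. Re (f z) \<partial>circle_measure) = 1"
      using *  by (subst integral_Re) (simp_all add: c_def)
    then show ?thesis by simp
  qed
  finally show ?thesis .
qed

text \<open>
  Off the circle \<open>r = \<bar>\<omega>\<bar>\<close> both sides agree: if \<open>r > \<bar>\<omega>\<bar>\<close> take \<open>r\<close> out of \<open>\<bar>r z - \<omega>\<bar>\<close>, otherwise take \<open>\<bar>\<omega>\<bar>\<close>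
  out, and what remains is a Poisson kernel. On that circle the left-hand side is infinite and the
  kernel is compared with Poisson kernels whose parameter tends to the circle. The lower bound
  covers the case that \<open>\<nu>\<close> charges the radius \<open>\<bar>\<omega>\<bar>\<close>.
\<close>

lemma nn_integral_inverse_square_circle:
  fixes \<omega> :: complex and r :: real
  assumes r: "r > 0"
  shows "1 / ennreal \<bar>r\<^sup>2 - (cmod \<omega>)\<^sup>2\<bar> \<le>
    (\<integral>\<^sup>+z. 1 / ennreal ((cmod (of_real r * z - \<omega>))\<^sup>2) \<partial>circle_measure)" (is "_ \<le> ?I")
proof -
  interpret prob_space circle_measure by (rule prob_space_circle_measure)
  define a where "a = cmod \<omega>"
  have a: "a \<ge> 0" by (simp add: a_def)
  have key: "ennreal (1 / (b * (1 - (cmod w)\<^sup>2))) \<le> ?I"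
    if w: "cmod w < 1" and b: "b > 0"
      and le: "\<And>z. z \<in> sphere 0 1 \<Longrightarrow> (cmod (of_real r * z - \<omega>))\<^sup>2 \<le> b * (cmod (1 - w * z))\<^sup>2" for w b
  proof -
    have "ennreal (1 / (b * (1 - (cmod w)\<^sup>2))) =
        ennreal (1 / b) * (\<integral>\<^sup>+z. ennreal (1 / (cmod (1 - w * z))\<^sup>2) \<partial>circle_measure)"
      using b w by (simp add: nn_integral_Poisson_kernel[OF w] ennreal_mult[symmetric] power_le_one)
    also have "\<dots> = (\<integral>\<^sup>+z. ennreal (1 / b) * ennreal (1 / (cmod (1 - w * z))\<^sup>2) \<partial>circle_measure)"
    proof (rule nn_integral_cmult[symmetric])
      have "(\<lambda>z. 1 - w * z) \<in> borel_measurable circle_measure"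
        by (intro circle_measurable_continuous continuous_intros)
      then show "(\<lambda>z. ennreal (1 / (cmod (1 - w * z))\<^sup>2)) \<in> borel_measurable circle_measure"
        by measurable
    qed
    also have "\<dots> \<le> ?I"
    proof (rule nn_integral_mono)
      fix z assume "z \<in> space circle_measure"
      then have z: "z \<in> sphere 0 1" by (simp add: space_circle_measure)
      have "cmod (w * z) < 1" using z w by (simp add: norm_mult)
      then have "1 - w * z \<noteq> 0" by auto
      then have pos: "b * (cmod (1 - w * z))\<^sup>2 > 0" using b by simp
      show "ennreal (1 / b) * ennreal (1 / (cmod (1 - w * z))\<^sup>2) \<le>
          1 / ennreal ((cmod (of_real r * z - \<omega>))\<^sup>2)"
      proof (cases "of_real r * z = \<omega>")
        case True
        then show ?thesis by (simp add: ennreal_divide_zero)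
      next
        case False
        have "1 / (b * (cmod (1 - w * z))\<^sup>2) \<le> 1 / ((cmod (of_real r * z - \<omega>))\<^sup>2)"
          using False le[OF z] by (intro divide_left_mono) (auto intro!: mult_pos_pos simp: pos b \<open>1 - w * z \<noteq> 0\<close>)
        then show ?thesis
          using False b
          by (simp add: ennreal_mult[symmetric] ennreal_1[symmetric] divide_ennreal ennreal_leI del: ennreal_1)
      qed
    qed
    finally show ?thesis .
  qed
  consider "r > a" | "r < a" | "r = a" by linarith
  then show ?thesis
  proof cases
    case 1
    have sq: "a\<^sup>2 < r\<^sup>2" using 1 a by (intro power_strict_mono) auto
    have "ennreal (1 / (r\<^sup>2 * (1 - (cmod (cnj \<omega> / of_real r))\<^sup>2))) \<le> ?I"
    proof (rule key)
      show "cmod (cnj \<omega> / of_real r) < 1" using 1 r by (simp add: norm_divide a_def)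
      fix z :: complex assume z: "z \<in> sphere 0 1"
      then have zz: "z * cnj z = 1" by (simp add: complex_norm_square[symmetric])
      have "of_real r * z - \<omega> = of_real r * z * cnj (1 - cnj \<omega> / of_real r * z)"
        using r zz by (simp add: field_simps)
      then have "cmod (of_real r * z - \<omega>) = r * cmod (1 - cnj \<omega> / of_real r * z)"
        using r z by (simp only: norm_mult complex_mod_cnj) simp
      then show "(cmod (of_real r * z - \<omega>))\<^sup>2 \<le> r\<^sup>2 * (cmod (1 - cnj \<omega> / of_real r * z))\<^sup>2"
        by (simp only: power_mult_distrib)
    qed (use r in simp)
    moreover have "r\<^sup>2 * (1 - (cmod (cnj \<omega> / of_real r))\<^sup>2) = \<bar>r\<^sup>2 - a\<^sup>2\<bar>"
    proof -
      have "cmod (cnj \<omega> / of_real r) = a / r"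
        using r by (simp add: norm_divide a_def)
      moreover have "r\<^sup>2 * (1 - (a / r)\<^sup>2) = r\<^sup>2 - a\<^sup>2"
        using r by (simp add: power_divide algebra_simps)
      ultimately show ?thesis using sq by (simp only: abs_of_pos diff_gt_0_iff_gt)
    qed
    ultimately show ?thesis
      using sq by (simp add: a_def[symmetric] ennreal_1[symmetric] divide_ennreal del: ennreal_1)
  next
    case 2
    have sq: "r\<^sup>2 < a\<^sup>2" using 2 r by (intro power_strict_mono) auto
    have l0: "\<omega> \<noteq> 0" using 2 r by (auto simp: a_def)
    have "ennreal (1 / (a\<^sup>2 * (1 - (cmod (of_real r / \<omega>))\<^sup>2))) \<le> ?I"
    proof (rule key)
      show "cmod (of_real r / \<omega>) < 1" using 2 r l0 by (simp add: norm_divide a_def)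
      fix z :: complex
      have "of_real r * z - \<omega> = - \<omega> * (1 - of_real r / \<omega> * z)"
        using l0 by (simp add: field_simps)
      then have "cmod (of_real r * z - \<omega>) = a * cmod (1 - of_real r / \<omega> * z)"
        by (simp only: norm_mult norm_minus_cancel a_def)
      then show "(cmod (of_real r * z - \<omega>))\<^sup>2 \<le> a\<^sup>2 * (cmod (1 - of_real r / \<omega> * z))\<^sup>2"
        by (simp only: power_mult_distrib)
    qed (use l0 in \<open>simp add: a_def\<close>)
    moreover have "a\<^sup>2 * (1 - (cmod (of_real r / \<omega>))\<^sup>2) = \<bar>r\<^sup>2 - a\<^sup>2\<bar>"
    proof -
      have "cmod (of_real r / \<omega>) = r / a"
        using r by (simp add: norm_divide a_def)
      moreover have "a\<^sup>2 * (1 - (r / a)\<^sup>2) = a\<^sup>2 - r\<^sup>2"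
        using 2 r by (simp add: power_divide algebra_simps)
      ultimately show ?thesis using sq by (simp only: abs_of_neg diff_less_0_iff_less minus_diff_eq)
    qed
    ultimately show ?thesis
      using sq by (simp add: a_def[symmetric] ennreal_1[symmetric] divide_ennreal del: ennreal_1)
  next
    case 3
    then have a_pos: "a > 0" using r by simp
    have l0: "\<omega> \<noteq> 0" using a_pos by (auto simp: a_def)
    \<comment> \<open>For \<open>\<bar>\<eta>\<bar> = 1\<close> and \<open>0 < s < 1\<close> one has \<open>\<bar>1 - \<eta>z\<bar> \<le> 2 \<bar>1 - s\<eta>z\<bar>\<close> on the circle, and the Poisson kernel at \<open>s\<eta>\<close>
        is integrable with integral \<open>1/(1 - s\<^sup>2)\<close>, which is unbounded in \<open>s\<close>.\<close>
    define \<eta> where "\<eta> = cnj \<omega> / of_real r"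
    have \<eta>: "cmod \<eta> = 1" using 3 r by (simp add: \<eta>_def norm_divide a_def)
    have bound: "ennreal (1 / (4 * r\<^sup>2 * (1 - s\<^sup>2))) \<le> ?I" if s: "0 < s" "s < 1" for s
    proof -
      have "ennreal (1 / (4 * r\<^sup>2 * (1 - (cmod (of_real s * \<eta>))\<^sup>2))) \<le> ?I"
      proof (rule key)
        show "cmod (of_real s * \<eta>) < 1" using s \<eta> by (simp add: norm_mult)
        fix z :: complex assume z: "z \<in> sphere 0 1"
        then have zz: "z * cnj z = 1" by (simp add: complex_norm_square[symmetric])
        have "of_real r * z - \<omega> = of_real r * z * cnj (1 - \<eta> * z)"
          using r zz by (simp add: field_simps \<eta>_def)
        then have 1: "cmod (of_real r * z - \<omega>) = r * cmod (1 - \<eta> * z)"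
          using r z by (simp only: norm_mult complex_mod_cnj) simp
        have n: "cmod (\<eta> * z) = 1" "cmod (of_real s * \<eta> * z) = s"
          using z \<eta> s by (simp_all add: norm_mult)
        have "cmod (1 - \<eta> * z) \<le> cmod (1 - of_real s * \<eta> * z) + cmod (of_real s * \<eta> * z - \<eta> * z)"
          using norm_triangle_ineq[of "1 - of_real s * \<eta> * z" "of_real s * \<eta> * z - \<eta> * z"] by simp
        also have "of_real s * \<eta> * z - \<eta> * z = - (of_real (1 - s) * (\<eta> * z))"
          by (simp add: algebra_simps)
        also have "cmod (- (of_real (1 - s) * (\<eta> * z))) = 1 - s"
          using s n by (simp only: norm_minus_cancel norm_mult[of "of_real (1 - s)"] norm_of_real) simp
        \<comment> \<open>The point \<open>s\<eta>z\<close> has modulus \<open>s\<close>, so its distance to \<open>1\<close> is at least \<open>1 - s\<close>.\<close>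
        also have "1 - s \<le> cmod (1 - of_real s * \<eta> * z)"
          using norm_triangle_ineq2[of 1 "of_real s * \<eta> * z"] n by simp
        finally have "cmod (1 - \<eta> * z) \<le> 2 * cmod (1 - of_real s * \<eta> * z)" by simp
        then have "r * cmod (1 - \<eta> * z) \<le> r * (2 * cmod (1 - of_real s * \<eta> * z))"
          using r by (intro mult_left_mono) auto
        then have "(cmod (of_real r * z - \<omega>))\<^sup>2 \<le> (r * (2 * cmod (1 - of_real s * \<eta> * z)))\<^sup>2"
          using r unfolding 1 by (intro power_mono) auto
        then show "(cmod (of_real r * z - \<omega>))\<^sup>2 \<le> 4 * r\<^sup>2 * (cmod (1 - of_real s * \<eta> * z))\<^sup>2"
          by (simp add: power_mult_distrib)
      qed (use r in simp)
      then show ?thesis using \<eta> s by (simp add: norm_mult)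
    qed
    have "?I = \<infinity>"
    proof (rule ccontr)
      assume "?I \<noteq> \<infinity>"
      then obtain B where B: "?I = ennreal B" "B \<ge> 0" by (cases ?I) auto
      \<comment> \<open>Choose \<open>s\<close> so close to \<open>1\<close> that the bound exceeds \<open>B\<close>; the \<open>1/2\<close> only keeps \<open>s\<close> positive.\<close>
      define b where "b = 4 * r\<^sup>2 * (B + 1)"
      have b: "b > 0" using r B by (simp add: b_def)
      define s where "s = sqrt (max (1/2) (1 - 1 / b))"
      have s2: "s\<^sup>2 = max (1/2) (1 - 1 / b)" by (simp add: s_def)
      have s: "0 < s" "s < 1" using b by (auto simp: s_def)
      have s2': "1 - s\<^sup>2 > 0" "1 - s\<^sup>2 \<le> 1 / b" using b by (auto simp: s2)
      have "1 / (4 * r\<^sup>2 * (1 - s\<^sup>2)) \<le> B"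
        using bound[OF s] B s by simp
      moreover have "B + 1 \<le> 1 / (4 * r\<^sup>2 * (1 - s\<^sup>2))"
        using s2' b r B by (simp add: b_def field_simps)
      ultimately show False by simp
    qed
    then show ?thesis by simp
  qed
qed

section \<open>Analytic functions in the closure of the polynomials\<close>

locale radial_measure = finite_measure \<nu> for \<nu> :: "real measure" +
  assumes sets_\<nu>: "sets \<nu> = sets (restrict_space borel {0<..<1})"
begin

abbreviation \<mu> :: "complex measure" where "\<mu> \<equiv> polar_measure \<nu>"

lemma space_\<nu>: "space \<nu> = {0<..<1}"
  using sets_eq_imp_space_eq[OF sets_\<nu>] by (simp add: space_restrict_space)

lemma space_\<mu>: "space \<mu> = ball 0 1"
  by (simp add: polar_measure_def space_restrict_space)

lemma borel_measurable_\<nu>: "f \<in> borel_measurable borel \<Longrightarrow> f \<in> borel_measurable \<nu>"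
  unfolding measurable_cong_sets[OF sets_\<nu> refl] by (rule measurable_restrict_space1)

lemma borel_measurable_\<mu>: "continuous_on (ball 0 1) f \<Longrightarrow> f \<in> borel_measurable \<mu>"
  unfolding measurable_cong_sets[OF sets_polar_measure refl]
  by (rule borel_measurable_continuous_on_restrict)

sublocale polar: finite_measure \<mu>
proof
  interpret circle: prob_space circle_measure by (rule prob_space_circle_measure)
  have "emeasure \<mu> (space \<mu>) = (\<integral>\<^sup>+z. 1 \<partial>\<mu>)"
    by simp
  also have "\<dots> = (\<integral>\<^sup>+r. (\<integral>\<^sup>+z. 1 \<partial>circle_measure) \<partial>\<nu>)"
    by (rule nn_integral_polar_measure[OF sets_\<nu>]) simp
  also have "\<dots> = emeasure \<nu> (space \<nu>)"
    by (simp add: circle.emeasure_space_1)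
  finally show "emeasure \<mu> (space \<mu>) \<noteq> \<infinity>"
    using emeasure_finite by simp
qed

lemma polar_integral:
  fixes h :: "complex \<Rightarrow> complex"
  assumes h: "integrable \<mu> h"
  shows "(\<integral>z. h z \<partial>\<mu>) = (\<integral>r. (\<integral>z. h (of_real r * z) \<partial>circle_measure) \<partial>\<nu>)"
proof -
  interpret circle: prob_space circle_measure by (rule prob_space_circle_measure)
  interpret pair_sigma_finite \<nu> circle_measure ..
  note m = polar_map_measurable[OF sets_\<nu>]
  have hm: "h \<in> borel_measurable (restrict_space borel (ball 0 1))"
    using h by (simp add: borel_measurable_integrable measurable_cong_sets[OF sets_polar_measure refl, symmetric])
  have int: "integrable (\<nu> \<Otimes>\<^sub>M circle_measure) (\<lambda>p. h (case p of (r, z) \<Rightarrow> of_real r * z))"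
    using h unfolding polar_measure_def by (subst (asm) integrable_distr_eq[OF m hm])
  have "(\<integral>z. h z \<partial>\<mu>) = (\<integral>p. h (case p of (r, z) \<Rightarrow> of_real r * z) \<partial>(\<nu> \<Otimes>\<^sub>M circle_measure))"
    unfolding polar_measure_def by (rule integral_distr[OF m hm])
  also have "\<dots> = (\<integral>r. (\<integral>z. h (of_real r * z) \<partial>circle_measure) \<partial>\<nu>)"
    using integral_fst'[OF int] by simp
  finally show ?thesis .
qed

text \<open>
  Points are null sets even if \<open>\<nu>\<close> has atoms, because the measure on the circle has none.
\<close>

lemma null_sets_point: "{w} \<inter> ball 0 1 \<in> null_sets \<mu>"
proof -
  have sets: "{w} \<inter> ball 0 1 \<in> sets (restrict_space borel (ball 0 1))"
    unfolding sets_restrict_space by (rule image_eqI[where x = "{w}"]) auto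
  have "emeasure \<mu> ({w} \<inter> ball 0 1) = (\<integral>\<^sup>+z. indicator ({w} \<inter> ball 0 1) z \<partial>\<mu>)"
    using sets by (simp add: sets_polar_measure)
  also have "\<dots> = (\<integral>\<^sup>+r. (\<integral>\<^sup>+z. indicator ({w} \<inter> ball 0 1) (of_real r * z) \<partial>circle_measure) \<partial>\<nu>)"
    using sets by (intro nn_integral_polar_measure sets_\<nu>) simp
  also have "\<dots> = (\<integral>\<^sup>+r. 0 \<partial>\<nu>)"
  proof (rule nn_integral_cong)
    fix r assume "r \<in> space \<nu>"
    then have r: "0 < r" "r < 1" by (auto simp: space_\<nu>)
    have "(\<integral>\<^sup>+z. indicator ({w} \<inter> ball 0 1) (of_real r * z) \<partial>circle_measure) =
        (\<integral>\<^sup>+z. 0 \<partial>circle_measure)"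
    proof (rule nn_integral_cong_AE)
      show "AE z in circle_measure. indicator ({w} \<inter> ball 0 1) (of_real r * z) = (0::ennreal)"
        using AE_not_in[OF circle_measure_point[of "w / of_real r"]] AE_space
      proof eventually_elim
        case (elim z)
        then show ?case
          using r by (auto simp: indicator_def space_circle_measure)
      qed
    qed
    then show "(\<integral>\<^sup>+z. indicator ({w} \<inter> ball 0 1) (of_real r * z) \<partial>circle_measure) = 0"
      by simp
  qed
  finally show ?thesis
    using sets by (auto simp: sets_polar_measure)
qed

lemma AE_not_in_countable:
  assumes "countable Z"
  shows "AE z in \<mu>. z \<notin> Z"
proof -
  have "(\<Union>w\<in>Z. {w} \<inter> ball 0 1) \<in> null_sets \<mu>"
    by (intro null_sets_UN' assms null_sets_point)
  from AE_not_in[OF this] AE_space show ?thesis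
    by eventually_elim (auto simp: space_\<mu>)
qed

lemma L2_bounded:
  assumes "continuous_on (ball 0 1) h" "\<And>z. z \<in> ball 0 1 \<Longrightarrow> cmod (h z) \<le> B"
  shows "h \<in> L2 \<mu>"
proof -
  have "(\<lambda>z. h z * 1) \<in> L2 \<mu>"
    using assms by (intro L2_mult_bounded[where B = B] borel_measurable_\<mu>) (auto simp: L2_def space_\<mu>)
  then show ?thesis by simp
qed

lemma poly_L2: "poly p \<in> L2 \<mu>"
proof -
  have "compact (poly p ` cball 0 1)"
    by (intro compact_continuous_image continuous_intros) auto
  then obtain B where "\<And>z. z \<in> cball 0 1 \<Longrightarrow> cmod (poly p z) \<le> B"
    by (meson bounded_iff compact_imp_bounded image_eqI)
  then show ?thesis
    by (intro L2_bounded[where B = B] continuous_intros) auto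
qed

lemma poly_monom_fun: "poly (monom 1 n) = (\<lambda>z :: complex. z ^ n)"
  by (rule ext) (simp add: poly_monom)

lemma monomial_L2: "(\<lambda>z. z ^ n) \<in> L2 \<mu>"
  using poly_L2[of "monom 1 n"] by (simp only: poly_monom_fun)

definition moment :: "nat \<Rightarrow> real" where
  "moment n = (\<integral>r. r ^ (2 * n) \<partial>\<nu>)"

text \<open>
  On the circle of radius \<open>r\<close> only the coefficient of \<open>z\<^sup>n\<close> survives, with weight \<open>r\<^sup>2\<^sup>n\<close>. The power series
  of \<open>k\<close> need not converge in \<open>L\<^sup>2\<close>, since the integration over the circle is carried out first.
\<close>

lemma L2_inner_monomial:
  assumes k: "k \<in> L2 \<mu>" and sums: "\<And>z. z \<in> ball 0 1 \<Longrightarrow> (\<lambda>m. c m * z ^ m) sums k z"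
  shows "L2_inner \<mu> k (\<lambda>z. z ^ n) = c n * moment n"
proof -
  have "L2_inner \<mu> k (\<lambda>z. z ^ n) =
      (\<integral>r. (\<integral>z. k (of_real r * z) * cnj ((of_real r * z) ^ n) \<partial>circle_measure) \<partial>\<nu>)"
    unfolding L2_inner_def by (rule polar_integral[OF L2_integrable_inner[OF k monomial_L2]])
  also have "\<dots> = (\<integral>r. c n * of_real (r ^ (2 * n)) \<partial>\<nu>)"
  proof (rule Bochner_Integration.integral_cong[OF refl])
    fix r assume "r \<in> space \<nu>"
    then have r: "0 < r" "r < 1" by (auto simp: space_\<nu>)
    define s where "s = (1 + r) / 2"
    have s: "r < s" "0 < s" "s < 1" using r by (auto simp: s_def)
    have "summable (\<lambda>m. c m * of_real s ^ m)"
      by (rule sums_summable[OF sums]) (use s in simp)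
    then have "summable (\<lambda>m. cmod (c m * of_real r ^ m))"
      by (rule powser_insidea) (use r s in simp)
    moreover have "(\<lambda>m. c m * of_real r ^ m * z ^ m) sums k (of_real r * z)" if "z \<in> sphere 0 1" for z
      using sums[of "of_real r * z"] that r by (simp add: norm_mult power_mult_distrib mult.assoc)
    ultimately have "(\<integral>z. k (of_real r * z) * cnj z ^ n \<partial>circle_measure) = c n * of_real r ^ n"
      by (rule circle_integral_power_series)
    then have "(\<integral>z. of_real r ^ n * (k (of_real r * z) * cnj z ^ n) \<partial>circle_measure) =
        of_real r ^ n * (c n * of_real r ^ n)"
      by simp
    then show "(\<integral>z. k (of_real r * z) * cnj ((of_real r * z) ^ n) \<partial>circle_measure) =
        c n * of_real (r ^ (2 * n))"
      by (simp add: power_mult_distrib mult_ac power_add mult_2_right)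
  qed
  also have "\<dots> = c n * moment n"
    by (simp add: moment_def del: of_real_power)
  finally show ?thesis .
qed

lemma L2_inner_poly_monomial: "L2_inner \<mu> (poly p) (\<lambda>z. z ^ n) = coeff p n * moment n"
proof (rule L2_inner_monomial[OF poly_L2])
  show "(\<lambda>m. coeff p m * z ^ m) sums poly p z" for z
    unfolding poly_altdef by (rule sums_finite) (auto simp: not_le coeff_eq_0)
qed

lemma L2_norm_monomial: "L2_norm \<mu> (\<lambda>z. z ^ n) = sqrt (moment n)"
proof -
  have "complex_of_real ((L2_norm \<mu> (\<lambda>z. z ^ n))\<^sup>2) = of_real (moment n)"
    using L2_inner_poly_monomial[of "monom 1 n" n]
    by (simp only: poly_monom_fun L2_inner_self[symmetric]) simp
  then have "(L2_norm \<mu> (\<lambda>z. z ^ n))\<^sup>2 = moment n"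
    by (simp only: of_real_eq_iff)
  then show ?thesis
    by (rule real_sqrt_unique[symmetric]) simp
qed

end

locale radial_measure_supp = radial_measure +
  assumes supp: "1 \<in> closed_support \<nu>"
begin

lemma measure_near_1_pos:
  assumes "s < 1"
  shows "measure \<nu> ({s<..} \<inter> {0<..<1}) > 0"
proof -
  have "emeasure \<nu> ({s<..} \<inter> {0<..<1}) > 0"
    using supp assms unfolding closed_support_def by (auto simp: space_\<nu>)
  then show ?thesis
    by (simp add: emeasure_eq_measure)
qed

text \<open>
  With \<open>s\<close> arbitrarily close to \<open>1\<close> the moments dominate geometric sequences of ratio close to \<open>1\<close>. This is
  where the position of the support enters.
\<close>

lemma moment_lower_bound:
  assumes s: "0 < s"
  shows "s ^ (2 * n) * measure \<nu> ({s<..} \<inter> {0<..<1}) \<le> moment n"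
proof -
  have sets: "{s<..} \<inter> {0<..<1} \<in> sets \<nu>"
    unfolding sets_\<nu> sets_restrict_space by (rule image_eqI[where x = "{s<..}"]) auto
  have "s ^ (2 * n) * measure \<nu> ({s<..} \<inter> {0<..<1}) = (\<integral>r. s ^ (2 * n) * indicator ({s<..} \<inter> {0<..<1}) r \<partial>\<nu>)"
    using sets by simp
  also have "\<dots> \<le> moment n"
    unfolding moment_def
  proof (rule integral_mono)
    show "integrable \<nu> (\<lambda>r. s ^ (2 * n) * indicator ({s<..} \<inter> {0<..<1}) r)"
      using sets emeasure_finite by (intro integrable_mult_right integrable_real_indicator) (auto simp: less_top[symmetric])
    show "integrable \<nu> (\<lambda>r. r ^ (2 * n))"
      by (rule integrable_const_bound[where B = 1])
        (auto simp: space_\<nu> power_le_one intro!: AE_I2 borel_measurable_\<nu>)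
    show "s ^ (2 * n) * indicator ({s<..} \<inter> {0<..<1}) r \<le> r ^ (2 * n)" if "r \<in> space \<nu>" for r
      using that s by (auto simp: indicator_def space_\<nu> intro!: power_mono)
  qed
  finally show ?thesis .
qed

lemma moment_pos: "moment n > 0"
proof -
  have "(1/2) ^ (2 * n) * measure \<nu> ({1/2<..} \<inter> {0<..<1}) > 0"
    by (intro mult_pos_pos measure_near_1_pos) simp_all
  also have "\<dots> \<le> moment n"
    by (rule moment_lower_bound) simp
  finally show ?thesis .
qed

lemma summable_moment:
  assumes \<rho>: "0 \<le> \<rho>" "\<rho> < 1"
  shows "summable (\<lambda>n. \<rho> ^ n / sqrt (moment n))"
proof -
  define s where "s = (1 + \<rho>) / 2"
  have s: "\<rho> < s" "0 < s" "s < 1" using \<rho> by (auto simp: s_def)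
  define c where "c = measure \<nu> ({s<..} \<inter> {0<..<1})"
  have c: "c > 0" unfolding c_def by (rule measure_near_1_pos[OF s(3)])
  have "summable (\<lambda>n. (\<rho> / s) ^ n / sqrt c)"
    using s \<rho> by (intro summable_divide summable_geometric) auto
  then show ?thesis
  proof (rule summable_comparison_test'[where N = 0])
    fix n :: nat
    have "(s ^ n * sqrt c)\<^sup>2 \<le> moment n"
      using moment_lower_bound[OF s(2), of n] c
      by (simp add: c_def[symmetric] power_mult_distrib power_mult[symmetric] mult.commute)
    then have le: "s ^ n * sqrt c \<le> sqrt (moment n)"
      by (rule real_le_rsqrt)
    have "\<rho> ^ n / sqrt (moment n) \<le> \<rho> ^ n / (s ^ n * sqrt c)"
      using le s c \<rho> moment_pos[of n] by (intro divide_left_mono) auto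
    then show "norm (\<rho> ^ n / sqrt (moment n)) \<le> (\<rho> / s) ^ n / sqrt c"
      using \<rho> moment_pos[of n] by (simp add: power_divide)
  qed
qed

text \<open>
  The coefficients \<open>a\<^sub>n = \<langle>f, z\<^sup>n\<rangle> / \<parallel>z\<^sup>n\<parallel>\<^sup>2\<close> differ from those of a polynomial \<open>p\<close> by at most \<open>\<parallel>f - p\<parallel> / \<parallel>z\<^sup>n\<parallel>\<close>.
  By \<open>summable_moment\<close> the series with coefficients \<open>a\<^sub>n\<close> converges in the disc to a function \<open>F\<close> with
  \<open>\<bar>F z - p z\<bar> \<le> C \<rho> \<parallel>f - p\<parallel>\<close> for \<open>\<bar>z\<bar> \<le> \<rho>\<close>. Polynomials close to \<open>f\<close> in norm are therefore close to \<open>F\<close> uniformly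
  on that smaller disc, and \<open>f\<close> agrees with \<open>F\<close> there.
\<close>

lemma polynomial_limit_analytic:
  assumes f: "f \<in> L2 \<mu>"
    and approx: "\<And>e. e > 0 \<Longrightarrow> \<exists>p. L2_norm \<mu> (\<lambda>z. f z - poly p z) < e"
  obtains F where "F holomorphic_on ball 0 1" "AE z in \<mu>. f z = F z"
proof -
  define a where "a n = L2_inner \<mu> f (\<lambda>z. z ^ n) / moment n" for n
  define N where "N p = L2_norm \<mu> (\<lambda>z. f z - poly p z)" for p
  define C where "C \<rho> = (\<Sum>n. \<rho> ^ n / sqrt (moment n))" for \<rho> :: real
  have coeff_bound: "cmod (a n - coeff p n) \<le> N p / sqrt (moment n)" for n p
  proof -
    have "a n - coeff p n = L2_inner \<mu> (\<lambda>z. f z - poly p z) (\<lambda>z. z ^ n) / moment n"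
      using moment_pos[of n]
      by (simp add: a_def L2_inner_diff_left f poly_L2 monomial_L2 L2_inner_poly_monomial field_simps)
    then have "cmod (a n - coeff p n) = cmod (L2_inner \<mu> (\<lambda>z. f z - poly p z) (\<lambda>z. z ^ n)) / moment n"
      using moment_pos[of n] by (simp add: norm_divide)
    also have "\<dots> \<le> (N p * sqrt (moment n)) / moment n"
      using L2_Cauchy_Schwarz[OF L2_diff[OF f poly_L2] monomial_L2] moment_pos[of n]
      by (intro divide_right_mono) (auto simp: N_def L2_norm_monomial)
    also have "\<dots> = N p / sqrt (moment n)"
      using moment_pos[of n] by (simp add: field_simps)
    finally show ?thesis .
  qed
  have term_bound: "norm ((a n - coeff p n) * z ^ n) \<le> N p * (cmod z ^ n / sqrt (moment n))" for n p z
    using mult_right_mono[OF coeff_bound[of n p], of "cmod z ^ n"] by (simp add: norm_mult norm_power)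
  have maj: "summable (\<lambda>n. N p * (cmod z ^ n / sqrt (moment n)))" if "z \<in> ball 0 1" for p z
    using that by (intro summable_mult summable_moment) auto
  \<comment> \<open>The case \<open>p = 0\<close> of the coefficient bound gives convergence.\<close>
  define F where "F z = (\<Sum>n. a n * z ^ n)" for z
  have F_sums: "(\<lambda>n. a n * z ^ n) sums F z" if z: "z \<in> ball 0 1" for z
  proof -
    have "summable (\<lambda>n. a n * z ^ n)"
      by (rule summable_comparison_test'[OF maj[OF z, of 0], of 0]) (use term_bound[of _ 0 z] in simp)
    then show ?thesis
      unfolding F_def by (rule summable_sums)
  qed
  have hol: "F holomorphic_on ball 0 1"
    by (rule power_series_holomorphic[where a = a]) (use F_sums in simp)
  have pointwise: "cmod (F z - poly p z) \<le> N p * C \<rho>" if z: "cmod z \<le> \<rho>" and \<rho>: "\<rho> < 1" for z p \<rho>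
  proof -
    have zb: "z \<in> ball 0 1" using that by simp
    have \<rho>0: "0 \<le> \<rho>" using z norm_ge_zero order_trans by blast
    have "(\<lambda>n. coeff p n * z ^ n) sums poly p z"
      unfolding poly_altdef by (rule sums_finite) (auto simp: not_le coeff_eq_0)
    from sums_diff[OF F_sums[OF zb] this]
    have "F z - poly p z = (\<Sum>n. (a n - coeff p n) * z ^ n)"
      by (simp add: sums_iff left_diff_distrib)
    also have "cmod \<dots> \<le> (\<Sum>n. N p * (cmod z ^ n / sqrt (moment n)))"
      by (rule norm_suminf_le[OF term_bound maj[OF zb]])
    also have "\<dots> \<le> (\<Sum>n. N p * (\<rho> ^ n / sqrt (moment n)))"
      using z \<rho> \<rho>0 moment_pos
      by (intro suminf_le maj[OF zb] summable_mult summable_moment)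
        (auto intro!: mult_left_mono divide_right_mono power_mono simp: N_def less_imp_le)
    also have "\<dots> = N p * C \<rho>"
      unfolding C_def by (intro suminf_mult summable_moment \<rho> \<rho>0)
    finally show ?thesis .
  qed
  have [measurable]: "f \<in> borel_measurable \<mu>" using f by (simp add: L2_def)
  have [measurable]: "F \<in> borel_measurable \<mu>"
    by (intro borel_measurable_\<mu> holomorphic_on_imp_continuous_on hol)
  have inside: "AE z in \<mu>. cmod z \<le> \<rho> \<longrightarrow> f z = F z" if \<rho>: "0 \<le> \<rho>" "\<rho> < 1" for \<rho>
  proof -
    define V where "V = measure \<mu> (space \<mu>)"
    define I where "I = (\<integral>\<^sup>+z. (if cmod z \<le> \<rho> then ennreal ((cmod (f z - F z))\<^sup>2) else 0) \<partial>\<mu>)"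
    have [measurable]: "cmod \<in> borel_measurable \<mu>"
      by (intro borel_measurable_\<mu> continuous_intros)
    have bound: "I \<le> ennreal (e\<^sup>2 * (2 + 2 * (C \<rho>)\<^sup>2 * V))" if e: "e > 0" for e
    proof -
      obtain p where p: "N p < e" using approx[OF e] by (auto simp: N_def)
      have N0: "N p \<ge> 0" by (simp add: N_def)
      have C0: "C \<rho> \<ge> 0"
        unfolding C_def using \<rho> moment_pos by (intro suminf_nonneg summable_moment) (auto simp: less_imp_le)
      have int: "integrable \<mu> (\<lambda>z. (cmod (f z - poly p z))\<^sup>2)"
        using L2_diff[OF f poly_L2[of p]] by (simp add: L2_def)
      have "I \<le> (\<integral>\<^sup>+z. ennreal (2 * (cmod (f z - poly p z))\<^sup>2 + 2 * (N p * C \<rho>)\<^sup>2) \<partial>\<mu>)"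
        unfolding I_def
      proof (rule nn_integral_mono)
        fix z
        have "(cmod (f z - F z))\<^sup>2 \<le> 2 * (cmod (f z - poly p z))\<^sup>2 + 2 * (N p * C \<rho>)\<^sup>2" if z: "cmod z \<le> \<rho>"
        proof -
          have "cmod (f z - F z) \<le> cmod (f z - poly p z) + cmod (F z - poly p z)"
            using norm_triangle_ineq4[of "f z - poly p z" "F z - poly p z"] by simp
          also have "\<dots> \<le> cmod (f z - poly p z) + N p * C \<rho>"
            using pointwise[OF z \<rho>(2)] by simp
          finally have "(cmod (f z - F z))\<^sup>2 \<le> (cmod (f z - poly p z) + N p * C \<rho>)\<^sup>2"
            by (intro power_mono) auto
          also have "\<dots> \<le> 2 * (cmod (f z - poly p z))\<^sup>2 + 2 * (N p * C \<rho>)\<^sup>2"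
            using sum_squares_bound[of "cmod (f z - poly p z)" "N p * C \<rho>"] by (simp add: power2_sum)
          finally show ?thesis .
        qed
        then show "(if cmod z \<le> \<rho> then ennreal ((cmod (f z - F z))\<^sup>2) else 0) \<le>
            ennreal (2 * (cmod (f z - poly p z))\<^sup>2 + 2 * (N p * C \<rho>)\<^sup>2)"
          by (cases "cmod z \<le> \<rho>") (simp_all only: if_True if_False ennreal_leI zero_le)
      qed
      also have "\<dots> = ennreal (\<integral>z. 2 * (cmod (f z - poly p z))\<^sup>2 + 2 * (N p * C \<rho>)\<^sup>2 \<partial>\<mu>)"
        by (intro nn_integral_eq_integral Bochner_Integration.integrable_add
            Bochner_Integration.integrable_mult_right int polar.integrable_const AE_I2) simp
      also have "(\<integral>z. 2 * (cmod (f z - poly p z))\<^sup>2 + 2 * (N p * C \<rho>)\<^sup>2 \<partial>\<mu>) = 2 * (N p)\<^sup>2 + 2 * (N p * C \<rho>)\<^sup>2 * V"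
        using int by (simp add: N_def L2_norm_power2 V_def)
      also have "\<dots> = (N p)\<^sup>2 * (2 + 2 * (C \<rho>)\<^sup>2 * V)"
        by (simp add: power_mult_distrib algebra_simps)
      also have "ennreal \<dots> \<le> ennreal (e\<^sup>2 * (2 + 2 * (C \<rho>)\<^sup>2 * V))"
        using p N0 by (intro ennreal_leI mult_right_mono power_mono) (auto simp: V_def)
      finally show ?thesis .
    qed
    have "I \<le> 0"
    proof (rule ennreal_le_epsilon)
      fix d :: real assume d: "d > 0"
      define K where "K = 2 + 2 * (C \<rho>)\<^sup>2 * V"
      have K: "K > 0" by (simp add: K_def V_def add_pos_nonneg)
      have "I \<le> ennreal ((sqrt (d / K))\<^sup>2 * K)"
        unfolding K_def by (rule bound) (use d K in \<open>simp add: K_def\<close>)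
      also have "(sqrt (d / K))\<^sup>2 * K = d"
        using d K by simp
      finally show "I \<le> 0 + ennreal d" by simp
    qed
    then have "AE z in \<mu>. (if cmod z \<le> \<rho> then ennreal ((cmod (f z - F z))\<^sup>2) else 0) = 0"
      unfolding I_def by (subst nn_integral_0_iff_AE[symmetric]) auto
    then show ?thesis
    proof eventually_elim
      case (elim z)
      then show ?case by (cases "cmod z \<le> \<rho>") simp_all
    qed
  qed
  have "AE z in \<mu>. \<forall>k. cmod z \<le> 1 - 1 / real (Suc k) \<longrightarrow> f z = F z"
    unfolding AE_all_countable
  proof
    show "AE z in \<mu>. cmod z \<le> 1 - 1 / real (Suc k) \<longrightarrow> f z = F z" for k
      by (rule inside) simp_all
  qed
  then have "AE z in \<mu>. f z = F z"
    using AE_space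
  proof eventually_elim
    case (elim z)
    then have "1 - cmod z > 0" by (simp add: space_\<mu>)
    then obtain k where "inverse (real (Suc k)) < 1 - cmod z"
      using reals_Archimedean by blast
    then have "cmod z \<le> 1 - 1 / real (Suc k)" by (simp add: field_simps inverse_eq_divide)
    then show ?case using elim by blast
  qed
  with hol show thesis by (rule that)
qed

lemma analytic_orth_monomials_eq_0:
  assumes k: "k holomorphic_on ball 0 1" "k \<in> L2 \<mu>"
    and orth: "\<And>n. L2_inner \<mu> k (\<lambda>z. z ^ n) = 0"
    and z: "z \<in> ball 0 1"
  shows "k z = 0"
proof -
  have sums: "(\<lambda>n. taylor_coeff k n * w ^ n) sums k w" if "w \<in> ball 0 1" for w
    using holomorphic_power_series[OF k(1) that] by (simp add: taylor_coeff_def)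
  have "taylor_coeff k n = 0" for n
    using L2_inner_monomial[OF k(2) sums, of n] orth[of n] moment_pos[of n] by simp
  then have "(\<lambda>n. 0) sums k z"
    using sums[OF z] by simp
  then show ?thesis
    using sums_unique2[OF sums_zero] by metis
qed

end

section \<open>Quotients of analytic functions\<close>

context radial_measure
begin

lemma nn_integral_inverse_square_disc:
  assumes div: "(\<integral>\<^sup>+r. 1 / ennreal \<bar>r\<^sup>2 - (cmod w)\<^sup>2\<bar> \<partial>\<nu>) = \<infinity>"
  shows "(\<integral>\<^sup>+z. 1 / ennreal ((cmod (z - w))\<^sup>2) \<partial>\<mu>) = \<infinity>"
proof -
  have "(\<lambda>z. (cmod (z - w))\<^sup>2) \<in> borel_measurable (restrict_space borel (ball 0 1))"
    by (intro borel_measurable_continuous_on_restrict continuous_intros)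
  then have "(\<lambda>z. 1 / ennreal ((cmod (z - w))\<^sup>2)) \<in> borel_measurable (restrict_space borel (ball 0 1))"
    by measurable
  then have "(\<integral>\<^sup>+z. 1 / ennreal ((cmod (z - w))\<^sup>2) \<partial>\<mu>) =
      (\<integral>\<^sup>+r. (\<integral>\<^sup>+z. 1 / ennreal ((cmod (of_real r * z - w))\<^sup>2) \<partial>circle_measure) \<partial>\<nu>)"
    by (rule nn_integral_polar_measure[OF sets_\<nu>])
  also have "\<dots> \<ge> (\<integral>\<^sup>+r. 1 / ennreal \<bar>r\<^sup>2 - (cmod w)\<^sup>2\<bar> \<partial>\<nu>)"
    by (intro nn_integral_mono nn_integral_inverse_square_circle) (simp add: space_\<nu>)
  finally show ?thesis
    using div by (simp add: top_unique)
qed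

text \<open>
  Near a pole at \<open>w\<close> one has \<open>\<bar>q z\<bar> \<ge> c / \<bar>z - w\<bar>\<close>, and away from \<open>w\<close> the function \<open>1 / \<bar>z - w\<bar>\<^sup>2\<close> is bounded; so a
  square integrable \<open>q\<close> with a pole would make \<open>1 / \<bar>z - w\<bar>\<^sup>2\<close> integrable.
\<close>

lemma square_integrable_not_pole:
  assumes div: "(\<integral>\<^sup>+r. 1 / ennreal \<bar>r\<^sup>2 - (cmod w)\<^sup>2\<bar> \<partial>\<nu>) = \<infinity>"
    and fin: "(\<integral>\<^sup>+z. ennreal ((cmod (q z))\<^sup>2) \<partial>\<mu>) < \<infinity>"
    and meas: "q \<in> borel_measurable \<mu>"
    and iso: "isolated_singularity_at q w"
  shows "\<not> is_pole q w"
proof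
  assume pole: "is_pole q w"
  obtain \<epsilon> where \<epsilon>: "\<epsilon> > 0" "q analytic_on ball w \<epsilon> - {w}"
    using iso unfolding isolated_singularity_at_def by blast
  define n g where "n = nat (- zorder q w)" and "g = zor_poly q w"
  have "zorder q w < 0 \<and> g w \<noteq> 0 \<and> (\<exists>r>0. cball w r \<subseteq> ball w \<epsilon> \<and> g holomorphic_on cball w r \<and>
      (\<forall>z\<in>cball w r - {w}. q z = g z / (z - w) ^ n \<and> g z \<noteq> 0))"
    unfolding n_def g_def
    using \<epsilon> by (intro zorder_exist_pole pole analytic_imp_holomorphic) auto
  then obtain r where r: "r > 0" "g holomorphic_on cball w r" "g w \<noteq> 0" and n: "n \<ge> 1"
    and q: "\<And>z. z \<in> cball w r \<Longrightarrow> z \<noteq> w \<Longrightarrow> q z = g z / (z - w) ^ n \<and> g z \<noteq> 0"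
    by (auto simp: n_def)
  have "\<exists>z0\<in>cball w r. \<forall>z\<in>cball w r. cmod (g z0) \<le> cmod (g z)"
    using r by (intro continuous_attains_inf continuous_on_norm holomorphic_on_imp_continuous_on) auto
  then obtain z0 where z0: "z0 \<in> cball w r" "\<And>z. z \<in> cball w r \<Longrightarrow> cmod (g z0) \<le> cmod (g z)"
    by blast
  define c where "c = cmod (g z0)"
  have c: "c > 0" using q[OF z0(1)] r(3) by (cases "z0 = w") (auto simp: c_def)
  \<comment> \<open>For \<open>\<bar>z - w\<bar> \<le> 1\<close> a pole of order \<open>n\<close> is at least as large as one of order \<open>1\<close>.\<close>
  define \<delta> where "\<delta> = min r 1"
  have \<delta>: "\<delta> > 0" "\<delta> \<le> 1" "\<delta> \<le> r" using r by (auto simp: \<delta>_def)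
  have bound: "1 / (cmod (z - w))\<^sup>2 \<le> (1 / c\<^sup>2) * (cmod (q z))\<^sup>2 + 1 / \<delta>\<^sup>2" if z: "z \<noteq> w" for z
  proof (cases "cmod (z - w) \<le> \<delta>")
    case True
    then have zr: "z \<in> cball w r" using \<delta> by (simp add: dist_norm norm_minus_commute)
    have pos: "cmod (z - w) > 0" using z by simp
    have "cmod (z - w) ^ n \<le> cmod (z - w) ^ 1"
      using n True \<delta> by (intro power_decreasing) auto
    then have "c / cmod (z - w) \<le> c / cmod (z - w) ^ n"
      using pos c by (intro divide_left_mono) auto
    also have "\<dots> \<le> cmod (g z) / cmod (z - w) ^ n"
      using z0(2)[OF zr] by (intro divide_right_mono) (auto simp: c_def)
    also have "\<dots> = cmod (q z)"
      using q[OF zr z] by (simp add: norm_divide norm_power)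
    finally have "(c / cmod (z - w))\<^sup>2 \<le> (cmod (q z))\<^sup>2"
      using c by (intro power_mono) auto
    then have "1 / (cmod (z - w))\<^sup>2 \<le> (1 / c\<^sup>2) * (cmod (q z))\<^sup>2"
      using c pos by (simp add: power_divide field_simps)
    then show ?thesis using \<delta> by (simp add: add_increasing2)
  next
    case False
    then have "1 / (cmod (z - w))\<^sup>2 \<le> 1 / \<delta>\<^sup>2"
      using \<delta> by (intro divide_left_mono power_mono mult_pos_pos zero_less_power) auto
    then show ?thesis by (simp add: add_increasing)
  qed
  have [measurable]: "q \<in> borel_measurable \<mu>" by (rule meas)
  have "AE z in \<mu>. z \<notin> {w}"
    by (rule AE_not_in_countable) simp
  then have "(\<integral>\<^sup>+z. 1 / ennreal ((cmod (z - w))\<^sup>2) \<partial>\<mu>) \<le>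
      (\<integral>\<^sup>+z. ennreal (1 / c\<^sup>2) * ennreal ((cmod (q z))\<^sup>2) + ennreal (1 / \<delta>\<^sup>2) \<partial>\<mu>)"
  proof (intro nn_integral_mono_AE, eventually_elim)
    case (elim z)
    then have z: "z \<noteq> w" by simp
    have "1 / ennreal ((cmod (z - w))\<^sup>2) = ennreal (1 / (cmod (z - w))\<^sup>2)"
      using z by (simp add: divide_ennreal ennreal_1[symmetric] del: ennreal_1)
    also have "\<dots> \<le> ennreal ((1 / c\<^sup>2) * (cmod (q z))\<^sup>2 + 1 / \<delta>\<^sup>2)"
      by (intro ennreal_leI bound z)
    also have "\<dots> = ennreal (1 / c\<^sup>2) * ennreal ((cmod (q z))\<^sup>2) + ennreal (1 / \<delta>\<^sup>2)"
      by (simp add: ennreal_mult[symmetric] flip: ennreal_plus)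
    finally show ?case .
  qed
  also have "\<dots> = ennreal (1 / c\<^sup>2) * (\<integral>\<^sup>+z. ennreal ((cmod (q z))\<^sup>2) \<partial>\<mu>) + ennreal (1 / \<delta>\<^sup>2) * emeasure \<mu> (space \<mu>)"
    by (simp add: nn_integral_add nn_integral_cmult)
  also have "\<dots> < \<infinity>"
    using fin polar.emeasure_finite[of "space \<mu>"]
    by (auto simp: ennreal_mult_less_top less_top[symmetric] ennreal_mult_eq_top_iff)
  finally show False
    using nn_integral_inverse_square_disc[OF div] by simp
qed

text \<open>
  The zeros of \<open>\<phi>\<close> are countably many, hence null, and off them \<open>h\<close> is the meromorphic function \<open>F/\<phi>\<close>.
  It inherits square integrability from \<open>h\<close>, and the divergence hypothesis then leaves it no poles; so its
  singularities are removable.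
\<close>

lemma square_integrable_quotient_analytic:
  assumes div: "\<And>a. a \<in> {0..<1} \<Longrightarrow> (\<integral>\<^sup>+r. 1 / ennreal \<bar>r\<^sup>2 - a\<^sup>2\<bar> \<partial>\<nu>) = \<infinity>"
    and F: "F holomorphic_on ball 0 1" and \<phi>: "\<phi> holomorphic_on ball 0 1"
    and nz: "\<exists>z\<in>ball 0 1. \<phi> z \<noteq> 0"
    and h: "h \<in> L2 \<mu>" and hF: "AE z in \<mu>. \<phi> z * h z = F z"
  obtains k where "k holomorphic_on ball 0 1" "AE z in \<mu>. h z = k z"
proof -
  define Z where "Z = {z \<in> ball 0 1. \<phi> z = 0}"
  have "countable Z"
  proof (cases "\<phi> constant_on ball 0 1")
    case True
    then have "Z = {}" using nz by (auto simp: Z_def constant_on_def)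
    then show ?thesis by simp
  next
    case False
    obtain C :: "nat \<Rightarrow> complex set" where "\<And>n. compact (C n)" "(\<Union>n. C n) = ball 0 1"
      using open_Union_compact_subsets[of "ball 0 1"] by (metis open_ball)
    then have "fsigma (ball 0 1 :: complex set)"
      unfolding fsigma_Union_compact by blast
    with False show ?thesis
      unfolding Z_def by (intro holomorphic_countable_zeros \<phi>) auto
  qed
  define q where "q z = F z / \<phi> z" for z
  have hq: "AE z in \<mu>. h z = q z"
    using hF AE_not_in_countable[OF \<open>countable Z\<close>] AE_space
    by eventually_elim (auto simp: q_def Z_def space_\<mu> field_simps)
  have [measurable]: "F \<in> borel_measurable \<mu>" "\<phi> \<in> borel_measurable \<mu>"
    using F \<phi> by (auto intro!: borel_measurable_\<mu> holomorphic_on_imp_continuous_on)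
  have qm: "q \<in> borel_measurable \<mu>"
    unfolding q_def by measurable
  have "(\<integral>\<^sup>+z. ennreal ((cmod (q z))\<^sup>2) \<partial>\<mu>) = (\<integral>\<^sup>+z. ennreal ((cmod (h z))\<^sup>2) \<partial>\<mu>)"
    using hq by (intro nn_integral_cong_AE) (auto elim!: eventually_mono)
  then have fin: "(\<integral>\<^sup>+z. ennreal ((cmod (q z))\<^sup>2) \<partial>\<mu>) < \<infinity>"
    by (simp add: nn_integral_L2_norm h)
  have mero: "q meromorphic_on ball 0 1"
    unfolding q_def using F \<phi>
    by (intro meromorphic_on_divide analytic_on_imp_meromorphic_on) (auto simp: analytic_on_open)
  define k where "k = remove_sings q"
  have "k analytic_on {w}" if w: "w \<in> ball 0 1" for w
  proof -
    have m: "q meromorphic_on {w}" using meromorphic_on_subset[OF mero] w by simp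
    have iso: "isolated_singularity_at q w" by (rule meromorphic_on_isolated_singularity[OF m])
    have "\<not> is_pole q w"
      using w by (intro square_integrable_not_pole div fin qm iso) auto
    then obtain c where "q \<midarrow>w\<rightarrow> c"
      using meromorphic_on_not_essential[OF m] by (auto simp: not_essential_def)
    then show ?thesis
      unfolding k_def by (rule remove_sings_analytic_at[OF iso])
  qed
  then have "k analytic_on ball 0 1"
    using analytic_on_analytic_at[of k "ball 0 1"] by blast
  then have "k holomorphic_on ball 0 1"
    by (rule analytic_imp_holomorphic)
  moreover have "AE z in \<mu>. h z = k z"
    using hq AE_not_in_countable[OF \<open>countable Z\<close>] AE_space
  proof eventually_elim
    case (elim z)
    then have "z \<in> ball 0 1" "\<phi> z \<noteq> 0" by (auto simp: space_\<mu> Z_def)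
    moreover have "F analytic_on {z}" "\<phi> analytic_on {z}"
      using F \<phi> \<open>z \<in> ball 0 1\<close> by (auto intro: holomorphic_on_imp_analytic_at)
    ultimately have "q analytic_on {z}"
      unfolding q_def by (intro analytic_on_divide) auto
    then show ?case
      using elim by (simp add: k_def)
  qed
  ultimately show thesis by (rule that)
qed

end

section \<open>Orthogonal complement of the conjugate polynomials\<close>

text \<open>
  A set of functions does not record exponents: to turn a polynomial into a linear combination over a
  set, the exponent must be recovered from the function \<open>z \<mapsto> cnj z ^ n\<close>, whose value at \<open>2\<close> determines it.
\<close>

lemma lin_span_conj_monomials:
  "lin_span (range (\<lambda>n z. cnj z ^ n)) = range (\<lambda>p z. cnj (poly p z))" (is "lin_span (range ?m) = ?P")
proof
  show "lin_span (range ?m) \<subseteq> ?P"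
  proof
    fix f assume "f \<in> lin_span (range ?m)"
    then obtain G c where G: "finite G" "G \<subseteq> range ?m" and f: "f = (\<lambda>z. \<Sum>g\<in>G. c g * g z)"
      unfolding lin_span_def by blast
    from G have "\<exists>p. (\<lambda>z. \<Sum>g\<in>G. c g * g z) = (\<lambda>z. cnj (poly p z))"
    proof (induction G rule: finite_induct)
      case empty
      show ?case by (intro exI[of _ 0]) simp
    next
      case (insert g G)
      then obtain p n where p: "(\<lambda>z. \<Sum>g\<in>G. c g * g z) = (\<lambda>z. cnj (poly p z))" and g: "g = ?m n"
        by auto
      have "(\<Sum>g\<in>insert g G. c g * g z) = cnj (poly (monom (cnj (c g)) n + p) z)" for z
        using insert.hyps fun_cong[OF p, of z] by (simp add: g poly_monom)
      then show ?case by blast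
    qed
    then show "f \<in> ?P" by (auto simp: f)
  qed
  show "?P \<subseteq> lin_span (range ?m)"
  proof safe
    fix p :: "complex poly"
    have inj: "inj ?m"
    proof (rule injI)
      fix m n assume "?m m = ?m n"
      from fun_cong[OF this, of 2] have "cmod (2 ^ m) = cmod (2 ^ n)" by simp
      then have "(2::real) ^ m = 2 ^ n" by (simp add: norm_power)
      then show "m = n" by simp
    qed
    define G where "G = ?m ` {..degree p}"
    define c where "c g = cnj (coeff p (inv ?m g))" for g
    have "cnj (poly p z) = (\<Sum>g\<in>G. c g * g z)" for z
    proof -
      have "(\<Sum>g\<in>G. c g * g z) = (\<Sum>n\<le>degree p. c (?m n) * ?m n z)"
        unfolding G_def using inj by (subst sum.reindex) (auto intro: inj_on_subset)
      also have "\<dots> = (\<Sum>n\<le>degree p. cnj (coeff p n * z ^ n))"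
        by (simp add: c_def inv_f_f[OF inj])
      finally show ?thesis by (simp add: poly_altdef)
    qed
    then have "(\<lambda>z. cnj (poly p z)) = (\<lambda>z. \<Sum>g\<in>G. c g * g z)" by blast
    moreover have "finite G" "G \<subseteq> range ?m" by (auto simp: G_def)
    ultimately show "(\<lambda>z. cnj (poly p z)) \<in> lin_span (range ?m)"
      unfolding lin_span_def by blast
  qed
qed

context radial_measure_supp
begin

definition conj_polys :: "(complex \<Rightarrow> complex) set" where
  "conj_polys = range (\<lambda>p z. cnj (poly p z))"

lemma conj_polys_L2: "conj_polys \<subseteq> L2 \<mu>"
  by (auto simp: conj_polys_def intro!: L2_cnj poly_L2)

lemma conj_polys_add: "a \<in> conj_polys \<Longrightarrow> b \<in> conj_polys \<Longrightarrow> (\<lambda>z. a z + b z) \<in> conj_polys"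
  unfolding conj_polys_def
proof safe
  fix p q :: "complex poly"
  show "(\<lambda>z. cnj (poly p z) + cnj (poly q z)) \<in> range (\<lambda>p z. cnj (poly p z))"
    by (rule range_eqI[of _ _ "p + q"]) simp
qed

lemma conj_polys_scale: "a \<in> conj_polys \<Longrightarrow> (\<lambda>z. c * a z) \<in> conj_polys"
  unfolding conj_polys_def
proof safe
  fix p :: "complex poly"
  show "(\<lambda>z. c * cnj (poly p z)) \<in> range (\<lambda>p z. cnj (poly p z))"
    by (rule range_eqI[of _ _ "smult (cnj c) p"]) simp
qed

lemma conj_P2_eq: "conj_P2 \<mu> = L2_closure \<mu> conj_polys"
  by (simp add: conj_P2_def lin_span_conj_monomials conj_polys_def)

abbreviation H :: "(complex \<Rightarrow> complex) set" where "H \<equiv> L2_orth \<mu> conj_polys"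

lemma H_eq: "L2_orth \<mu> (conj_P2 \<mu>) = H"
  unfolding conj_P2_eq by (rule L2_orth_closure[OF conj_polys_L2])

text \<open>
  Multiplication by \<open>z\<close> moves to the other side of the inner product as multiplication by \<open>cnj z\<close>, which
  preserves the conjugate polynomials.
\<close>

lemma H_mult: assumes f: "f \<in> H" shows "(\<lambda>z. z * f z) \<in> H"
  unfolding L2_orth_def
proof (intro CollectI conjI ballI)
  show "(\<lambda>z. z * f z) \<in> L2 \<mu>"
    using f by (intro L2_mult_bounded[where B = 1] borel_measurable_\<mu> continuous_intros)
      (auto simp: L2_orth_def space_\<mu>)
  fix a assume "a \<in> conj_polys"
  then obtain p where "a = (\<lambda>z. cnj (poly p z))" by (auto simp: conj_polys_def)
  then have "L2_inner \<mu> (\<lambda>z. z * f z) a = L2_inner \<mu> f (\<lambda>z. cnj (poly (pCons 0 p) z))"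
    by (simp add: L2_inner_def mult_ac)
  moreover have "L2_inner \<mu> f (\<lambda>z. cnj (poly (pCons 0 p) z)) = 0"
    using f unfolding L2_orth_def conj_polys_def by blast
  ultimately show "L2_inner \<mu> (\<lambda>z. z * f z) a = 0"
    by simp
qed

text \<open>
  The calculus consists of polynomials in the operator and two limits, and \<open>H\<close> is a closed invariant
  subspace.
\<close>

lemma H_calculus:
  assumes f: "f \<in> H" and g: "Hinf_calculus \<mu> (mult_op (\<lambda>z. z)) \<phi> f g"
  shows "g \<in> H"
proof -
  obtain S where S: "\<And>r. r \<in> {0<..<1} \<Longrightarrow> L2_tendsto \<mu>
      (\<lambda>N z. \<Sum>n<N. taylor_coeff \<phi> n * of_real r ^ n * (mult_op (\<lambda>z. z) ^^ n) f z) (S r) sequentially"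
    and Sg: "L2_tendsto \<mu> S g (at_left 1)"
    using g unfolding Hinf_calculus_def by blast
  have T: "(mult_op (\<lambda>z. z) ^^ n) f \<in> H" for n
  proof (induction n)
    case (Suc n)
    from H_mult[OF this] show ?case by (simp add: mult_op_def)
  qed (simp add: f)
  have "(\<lambda>z. 0) \<in> H"
    using L2_orth_scale[OF f, of 0] by simp
  then have "(\<lambda>z. \<Sum>n<N. c n * (mult_op (\<lambda>z. z) ^^ n) f z) \<in> H" for N and c :: "nat \<Rightarrow> complex"
    by (induction N) (simp_all add: L2_orth_add L2_orth_scale T conj_polys_L2)
  then have "S r \<in> H" if "r \<in> {0<..<1}" for r
    by (intro L2_orth_tendsto[OF S[OF that]] conj_polys_L2) auto
  moreover have "\<forall>\<^sub>F r in at_left (1::real). r \<in> {0<..<1}"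
    using eventually_at_left_real[of 0 1] by simp
  ultimately have "\<forall>\<^sub>F r in at_left 1. S r \<in> H"
    by (auto elim: eventually_mono)
  then show ?thesis
    by (intro L2_orth_tendsto[OF Sg] conj_polys_L2) (auto simp: trivial_limit_at_left_real)
qed

text \<open>
  The argument of the introduction from the orthogonality of \<open>g\<close> to \<open>\<phi>H\<close> to \<open>g = 0\<close>, with \<open>u\<close> in the place of
  \<open>\<phi> cnj g\<close>.
\<close>

lemma H_orth_range_eq_0:
  assumes div: "\<And>a. a \<in> {0..<1} \<Longrightarrow> (\<integral>\<^sup>+r. 1 / ennreal \<bar>r\<^sup>2 - a\<^sup>2\<bar> \<partial>\<nu>) = \<infinity>"
    and \<phi>: "\<phi> \<in> Hinf" and nz: "\<exists>z\<in>ball 0 1. \<phi> z \<noteq> 0"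
    and g: "g \<in> H" and orth: "\<And>f. f \<in> H \<Longrightarrow> L2_inner \<mu> (\<lambda>z. \<phi> z * f z) g = 0"
  shows "AE z in \<mu>. g z = 0"
proof -
  have hol: "\<phi> holomorphic_on ball 0 1" using \<phi> by (simp add: Hinf_def)
  have gL: "g \<in> L2 \<mu>" using g by (simp add: L2_orth_def)
  define u where "u z = \<phi> z * cnj (g z)" for z
  have uL: "u \<in> L2 \<mu>"
    using Hinf_mult_L2(1)[OF sets_polar_measure \<phi> L2_cnj[OF gL]] by (simp add: mult_op_def u_def[abs_def])
  have "(\<lambda>z. cnj (u z)) \<in> L2_closure \<mu> conj_polys"
  proof (rule L2_closureI_orth[OF conj_polys_L2 _ conj_polys_add conj_polys_scale L2_cnj[OF uL]])
    show "conj_polys \<noteq> {}" by (simp add: conj_polys_def)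
    fix f assume "f \<in> H"
    then have "cnj (L2_inner \<mu> (\<lambda>z. \<phi> z * f z) g) = 0" using orth by simp
    then show "L2_inner \<mu> (\<lambda>z. cnj (u z)) f = 0"
      by (simp add: L2_inner_def u_def mult_ac flip: Bochner_Integration.integral_cnj)
  qed
  then have approx: "\<exists>p. L2_norm \<mu> (\<lambda>z. u z - poly p z) < e" if e: "e > 0" for e
  proof -
    obtain p where "L2_norm \<mu> (\<lambda>z. cnj (u z) - cnj (poly p z)) < e"
      using \<open>(\<lambda>z. cnj (u z)) \<in> _\<close> e unfolding L2_closure_def conj_polys_def by blast
    then show ?thesis
      using L2_norm_cnj[of \<mu> "\<lambda>z. u z - poly p z"] by auto
  qed
  obtain F where F: "F holomorphic_on ball 0 1" "AE z in \<mu>. u z = F z"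
    using polynomial_limit_analytic[OF uL approx] by blast
  obtain k where k: "k holomorphic_on ball 0 1" and gk: "AE z in \<mu>. cnj (g z) = k z"
    using square_integrable_quotient_analytic[OF div F(1) hol nz L2_cnj[OF gL]] F(2)
    by (auto simp: u_def)
  have km: "k \<in> borel_measurable \<mu>"
    by (intro borel_measurable_\<mu> holomorphic_on_imp_continuous_on k)
  have gm: "(\<lambda>z. cnj (g z)) \<in> borel_measurable \<mu>" using L2_cnj[OF gL] by (simp add: L2_def)
  note [measurable] = km gm
  have kL: "k \<in> L2 \<mu>"
  proof -
    have [measurable]: "g \<in> borel_measurable \<mu>" using gL by (simp add: L2_def)
    have "AE z in \<mu>. (cmod (g z))\<^sup>2 = (cmod (k z))\<^sup>2"
      using gk by eventually_elim (metis complex_mod_cnj)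
    then have "integrable \<mu> (\<lambda>z. (cmod (g z))\<^sup>2) \<longleftrightarrow> integrable \<mu> (\<lambda>z. (cmod (k z))\<^sup>2)"
      by (intro integrable_cong_AE) simp_all
    then show ?thesis using gL km by (simp add: L2_def)
  qed
  have "L2_inner \<mu> k (\<lambda>z. z ^ n) = 0" for n
  proof -
    have pm: "(\<lambda>z. cnj (z ^ n)) \<in> borel_measurable \<mu>"
      by (intro borel_measurable_\<mu> continuous_intros)
    have "L2_inner \<mu> k (\<lambda>z. z ^ n) = (\<integral>z. cnj (g z) * cnj (z ^ n) \<partial>\<mu>)"
      unfolding L2_inner_def
    proof (rule integral_cong_AE)
      show "(\<lambda>z. k z * cnj (z ^ n)) \<in> borel_measurable \<mu>"
        "(\<lambda>z. cnj (g z) * cnj (z ^ n)) \<in> borel_measurable \<mu>"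
        by (rule borel_measurable_times[OF km pm] borel_measurable_times[OF gm pm])+
      show "AE z in \<mu>. k z * cnj (z ^ n) = cnj (g z) * cnj (z ^ n)"
        using gk by eventually_elim simp
    qed
    also have "\<dots> = cnj (L2_inner \<mu> g (\<lambda>z. cnj (poly (monom 1 n) z)))"
      by (simp add: L2_inner_def poly_monom flip: Bochner_Integration.integral_cnj)
    also have "\<dots> = 0"
      using g by (auto simp: L2_orth_def conj_polys_def)
    finally show ?thesis .
  qed
  then have k0: "k z = 0" if "z \<in> ball 0 1" for z
    using analytic_orth_monomials_eq_0[OF k kL _ that] by blast
  show ?thesis
    using gk AE_space by eventually_elim (auto simp: space_\<mu> k0)
qed

lemma Hinf_range_dense:
  assumes div: "\<And>a. a \<in> {0..<1} \<Longrightarrow> (\<integral>\<^sup>+r. 1 / ennreal \<bar>r\<^sup>2 - a\<^sup>2\<bar> \<partial>\<nu>) = \<infinity>"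
    and \<phi>: "\<phi> \<in> Hinf" and nz: "\<exists>z\<in>ball 0 1. \<phi> z \<noteq> 0"
  shows "L2_dense_in \<mu> (Hinf_range \<mu> (mult_op (\<lambda>z. z)) \<phi> H) H"
proof -
  define R where "R = mult_op \<phi> ` H"
  have R_range: "R \<subseteq> Hinf_range \<mu> (mult_op (\<lambda>z. z)) \<phi> H"
  proof (unfold R_def, safe)
    fix f assume f: "f \<in> H"
    then have fL: "f \<in> L2 \<mu>" by (simp add: L2_orth_def)
    have "Hinf_calculus \<mu> (mult_op (\<lambda>z. z)) \<phi> f (mult_op \<phi> f)"
      using Hinf_mult_L2(1)[OF sets_polar_measure \<phi> fL]
      by (subst Hinf_calculus_mult_op[OF sets_polar_measure \<phi> fL]) (simp add: mult_op_def)
    then show "mult_op \<phi> f \<in> Hinf_range \<mu> (mult_op (\<lambda>z. z)) \<phi> H"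
      using f by (auto simp: Hinf_range_def)
  qed
  have range_H: "Hinf_range \<mu> (mult_op (\<lambda>z. z)) \<phi> H \<subseteq> H"
    using H_calculus by (auto simp: Hinf_range_def)
  have R_H: "R \<subseteq> H" using R_range range_H by blast
  have H_L2: "H \<subseteq> L2 \<mu>" by (auto simp: L2_orth_def)
  have "H \<subseteq> L2_closure \<mu> R"
  proof
    fix h assume h: "h \<in> H"
    then have hL: "h \<in> L2 \<mu>" using H_L2 by blast
    show "h \<in> L2_closure \<mu> R"
    proof (rule L2_closureI_orth[OF _ _ _ _ hL])
      show "R \<subseteq> L2 \<mu>" using R_H H_L2 by blast
      show "R \<noteq> {}" using h by (auto simp: R_def)
      show "(\<lambda>z. a z + b z) \<in> R" if in_R: "a \<in> R" "b \<in> R" for a b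
      proof -
        obtain f1 f2 where "f1 \<in> H" "f2 \<in> H" and ab: "a = mult_op \<phi> f1" "b = mult_op \<phi> f2"
          using in_R unfolding R_def by blast
        then have "(\<lambda>z. f1 z + f2 z) \<in> H" by (intro L2_orth_add conj_polys_L2)
        moreover have "(\<lambda>z. a z + b z) = mult_op \<phi> (\<lambda>z. f1 z + f2 z)"
          by (simp add: ab mult_op_def distrib_left)
        ultimately show ?thesis by (auto simp: R_def)
      qed
      show "(\<lambda>z. c * a z) \<in> R" if in_R: "a \<in> R" for c a
      proof -
        obtain f where "f \<in> H" and a: "a = mult_op \<phi> f" using in_R by (auto simp: R_def)
        then have "(\<lambda>z. c * f z) \<in> H" by (intro L2_orth_scale)
        moreover have "(\<lambda>z. c * a z) = mult_op \<phi> (\<lambda>z. c * f z)"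
          by (simp add: a mult_op_def mult_ac)
        ultimately show ?thesis by (auto simp: R_def)
      qed
      fix p g assume p: "p \<in> L2_closure \<mu> R" and g: "g \<in> L2_orth \<mu> R" and gp: "g = (\<lambda>z. h z - p z)"
      have "p \<in> H"
        unfolding L2_orth_def
      proof (intro CollectI conjI ballI)
        show "p \<in> L2 \<mu>" using p by (simp add: L2_closure_def)
        fix a assume "a \<in> conj_polys"
        then show "L2_inner \<mu> p a = 0"
          using R_H H_L2 conj_polys_L2
          by (intro L2_inner_closure_eq_0[OF _ p]) (auto simp: L2_orth_def)
      qed
      then have "g \<in> H"
        using L2_orth_add[OF h L2_orth_scale[of p \<mu> conj_polys "-1"] conj_polys_L2] by (simp add: gp)
      moreover have "L2_inner \<mu> (\<lambda>z. \<phi> z * f z) g = 0" if "f \<in> H" for f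
        using g that L2_inner_eq_0_commute[of \<mu> g] by (auto simp: L2_orth_def R_def mult_op_def)
      ultimately have g0: "AE z in \<mu>. g z = 0"
        using H_orth_range_eq_0[OF div \<phi> nz] by blast
      have "L2_inner \<mu> h g = (\<integral>z. 0 \<partial>\<mu>)"
        unfolding L2_inner_def
      proof (rule integral_cong_AE)
        show "(\<lambda>z. h z * cnj (g z)) \<in> borel_measurable \<mu>"
          using L2_integrable_inner[OF hL subsetD[OF H_L2 \<open>g \<in> H\<close>]]
          by (rule borel_measurable_integrable)
        show "AE z in \<mu>. h z * cnj (g z) = 0"
          using g0 by eventually_elim simp
      qed simp
      then show "L2_inner \<mu> h g = 0" by simp
    qed
  qed
  also have "L2_closure \<mu> R \<subseteq> L2_closure \<mu> (Hinf_range \<mu> (mult_op (\<lambda>z. z)) \<phi> H)"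
    using R_range unfolding L2_closure_def by blast
  finally show ?thesis
    using range_H by (simp add: L2_dense_in_def)
qed

end

theorem corollary4p6:
  fixes \<nu> :: "real measure" and \<mu> :: "complex measure"
    and H :: "(complex \<Rightarrow> complex) set"
    and T :: "(complex \<Rightarrow> complex) \<Rightarrow> (complex \<Rightarrow> complex)"
    and \<phi> :: "complex \<Rightarrow> complex"
  assumes "sets \<nu> = sets (restrict_space borel {0<..<1})"
    and "finite_measure \<nu>"
    and "1 \<in> closed_support \<nu>"
    and "\<forall>a\<in>{0..<1}. (\<integral>\<^sup>+ r. 1 / ennreal \<bar>r\<^sup>2 - a\<^sup>2\<bar> \<partial>\<nu>) = \<infinity>"
    and "\<mu> = polar_measure \<nu>"
    and "H = L2_orth \<mu> (conj_P2 \<mu>)"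
    and "T = mult_op (\<lambda>z. z)"
    and "\<phi> \<in> Hinf"
    and "\<exists>z\<in>ball 0 1. \<phi> z \<noteq> 0"
  shows "L2_dense_in \<mu> (Hinf_range \<mu> T \<phi> H) H"
proof -
  interpret finite_measure \<nu> by (rule assms)
  interpret radial_measure_supp \<nu>
    by unfold_locales (use assms in auto)
  show ?thesis
    using Hinf_range_dense[of \<phi>] assms(4,8,9) unfolding assms(5-7) H_eq by blast
qed

end
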